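(* Let $k$ be a field, let $Q$ be a quiver, and let ${\bf a},{\bf b}\in(k^\times)^{Q_1}$. Then the following statements hold. (1) For $[p]\in\widetilde{Q}_\infty$ an irrational class, the two twisted representations $\mathcal{F}_{[p]}^{\bf a}$ and $\mathcal{F}_{[p]}^{\bf b}$ of $L_k(Q)$ are isomorphic. (2) For $[q^\infty]\in\widetilde{Q}_\infty$ a rational class with $q$ a simple oriented cycle, the two twisted representations $\mathcal{F}_{[q^\infty]}^{\bf a}$ and $\mathcal{F}_{[q^\infty]}^{\bf b}$ are isomorphic if and only if ${\bf a}{\bf b}^{-1}$ is $q$-stable. (3) For $i$ a sink of $Q$, the two twisted representations $\mathcal{N}_i^{\bf a}$ and $\mathcal{N}_i^{\bf b}$ are isomorphic.
   Context: A quiver $Q=(Q_0,Q_1;s,t)$ consists of a set $Q_0$ of vertices, a set $Q_1$ of arrows and maps $s,t\colon Q_1\to Q_0$ (starting and terminating vertex). A vertex is a sink if no arrow starts at it, an infinite emitter if infinitely many arrows start at it, and regular if it is neither. A finite path of length $n\ge1$ is a sequence $p=\alpha_n\cdots\alpha_2\alpha_1$ of arrows with $t(\alpha_i)=s(\alpha_{i+1})$; $s(p)=s(\alpha_1)$, $t(p)=t(\alpha_n)$; for each vertex $i$ there is a trivial path $e_i$ of length $0$ with $s(e_i)=t(e_i)=i$. Concatenation is written from right to left. An oriented cycle is a nontrivial path $p$ with $s(p)=t(p)$; it is simple if it is not a power of a shorter oriented cycle. Leavitt path algebra: $L_k(Q)$ is the $k$-algebra (algebras are not required to be unital) given by generators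 $\{e_i,\alpha,\alpha^*\mid i\in Q_0,\alpha\in Q_1\}$ subject to: (0) $e_ie_j=\delta_{ij}e_i$ for $i,j\in Q_0$; (1) $e_{t(\alpha)}\alpha=\alpha=\alpha e_{s(\alpha)}$; (2) $e_{s(\alpha)}\alpha^*=\alpha^*=\alpha^*e_{t(\alpha)}$; (3) $\alpha\beta^*=\delta_{\alpha,\beta}e_{t(\alpha)}$ for $\alpha,\beta\in Q_1$; (4) $\sum_{\{\alpha\in Q_1\mid s(\alpha)=i\}}\alpha^*\alpha=e_i$ for every regular vertex $i$. A representation is a $k$-vector space $M$ with an algebra homomorphism $L_k(Q)\to{\rm End}_k(M)$. A left-infinite path is an infinite sequence $p=\cdots\alpha_n\cdots\alpha_2\alpha_1$ of arrows with $t(\alpha_i)=s(\alpha_{i+1})$ for all $i\ge1$; $s(p)=s(\alpha_1)$; $Q_\infty$ is the set of them. For $n\ge0$, $\tau_{>n}(p)=\cdots\alpha_{n+2}\alpha_{n+1}$. Left-infinite paths $p,q$ are tail-equivalent if $\tau_{>n}(p)=\tau_{>m}(q)$ for some $n,m\ge0$; $[p]$ is the class of $p$ and $\widetilde{Q}_\infty$ the set of classes. For an oriented cycle $q$, $q^\infty=\cdots q\cdots qq$; such left-infinite paths are called cyclic. A left-infinite path $p$ is rational if it is tail-equivalent to a cyclic path, and irrational otherwise, i.e. $\tau_{>n}(p)\ne\tau_{>m}(p)$ for all distinct $n,m$; the class $[p]$ is then called a rational, resp. irrational, class. $\mathcal{F}$ is the $k$-vector space with basis $Q_\infty$, with $L_k(Q)$-action,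 for $p=\cdots\alpha_2\alpha_1$: $e_i.p=\delta_{i,s(p)}p$; $\alpha.p=\delta_{\alpha,\alpha_1}\tau_{>1}(p)$; $\alpha^*.p=p\alpha$ if $t(\alpha)=s(p)$ and $0$ otherwise. $\mathcal{F}_{[p]}$ is the subrepresentation spanned by $\{q\mid q\in[p]\}$. $\mathcal{N}$ is the $k$-vector space with basis the finite paths terminating at a sink (trivial paths at sinks included), with action: $e_i.p=\delta_{i,s(p)}p$; $\alpha.p=0$ if $p$ has length $0$, and $\alpha.p=\delta_{\alpha,\alpha_1}\,\alpha_n\cdots\alpha_2$ for $p=\alpha_n\cdots\alpha_2\alpha_1$ (read as $e_{t(\alpha_1)}$ when $n=1$); $\alpha^*.p=p\alpha$ if $t(\alpha)=s(p)$ and $0$ otherwise. For a sink $i$, $\mathcal{N}_i$ is the subrepresentation spanned by the paths $p$ with $t(p)=i$. Twisting: $k^\times$ is the multiplicative group of $k$ and $(k^\times)^{Q_1}$ the product group with componentwise multiplication. For ${\bf a}=(a_\alpha)_{\alpha\in Q_1}$, $\gamma_{\bf a}$ is the algebra automorphism of $L_k(Q)$ with $\gamma_{\bf a}(e_i)=e_i$, $\gamma_{\bf a}(\alpha)=a_\alpha\alpha$, $\gamma_{\bf a}(\alpha^* )=a_\alpha^{-1}\alpha^*$. For a representation $M$, the twisted representation $M^{\bf a}$ is $M$ as a vector space, with $u\in L_k(Q)$ acting on $M^{\bf a}$ as $\gamma_{\bf a}(u)$ acts on $M$. For a nontrivial path $p=\alpha_n\cdots\alpha_1$, $a_p=a_{\alpha_n}\cdots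 a_{\alpha_1}$, and ${\bf a}$ is called $p$-stable if $a_p=1$. *)

theory Defs
  imports
    "HOL-Library.FuncSet"
    "HOL-Library.Poly_Mapping"
    "HOL-Library.Stream"
    "Graph_Theory.Arc_Walk"
begin

section \<open>Vector spaces with a given basis\<close>

text \<open>
  The type \<^typ>\<open>'p \<Rightarrow>\<^sub>0 'k\<close> of finitely supported functions is the vector space with basis
  \<^typ>\<open>'p\<close>.  Vector spaces whose basis is a set \<open>P\<close> are subspaces of such a type.
\<close>

definition pscale :: "'k::field \<Rightarrow> ('p \<Rightarrow>\<^sub>0 'k) \<Rightarrow> ('p \<Rightarrow>\<^sub>0 'k)" where
  "pscale c f = Poly_Mapping.map ((*) c) f"

abbreviation basis_vec :: "'p \<Rightarrow> ('p \<Rightarrow>\<^sub>0 'k::field)" where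
  "basis_vec p \<equiv> Poly_Mapping.single p 1"

definition space_on :: "'p set \<Rightarrow> ('p \<Rightarrow>\<^sub>0 'k::field) set" where
  "space_on P = {f. Poly_Mapping.keys f \<subseteq> P}"

lemma lookup_pscale [simp]:
  "Poly_Mapping.lookup (pscale c f) p = c * Poly_Mapping.lookup f p"
  unfolding pscale_def by (simp add: Poly_Mapping.map.rep_eq when_def)

interpretation pscale: vector_space "pscale :: 'k::field \<Rightarrow> ('p \<Rightarrow>\<^sub>0 'k) \<Rightarrow> ('p \<Rightarrow>\<^sub>0 'k)"
  by unfold_locales (auto intro!: poly_mapping_eqI simp: lookup_add algebra_simps)


section \<open>Algebras, not necessarily unital, and their representations\<close>

record ('k, 'a) nualg =
  acarrier :: "'a set"
  azero :: 'a
  aadd :: "'a \<Rightarrow> 'a \<Rightarrow> 'a"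
  ascale :: "'k \<Rightarrow> 'a \<Rightarrow> 'a"
  amult :: "'a \<Rightarrow> 'a \<Rightarrow> 'a"

definition alg_hom :: "('k, 'a) nualg \<Rightarrow> ('k, 'b) nualg \<Rightarrow> ('a \<Rightarrow> 'b) set" where
  "alg_hom A B = {h \<in> acarrier A \<rightarrow>\<^sub>E acarrier B.
     h (azero A) = azero B \<and>
     (\<forall>x\<in>acarrier A. \<forall>y\<in>acarrier A. h (aadd A x y) = aadd B (h x) (h y)) \<and>
     (\<forall>c. \<forall>x\<in>acarrier A. h (ascale A c x) = ascale B c (h x)) \<and>
     (\<forall>x\<in>acarrier A. \<forall>y\<in>acarrier A. h (amult A x y) = amult B (h x) (h y))}"

definition End_alg ::
    "('k::field \<Rightarrow> 'm::ab_group_add \<Rightarrow> 'm) \<Rightarrow> 'm set \<Rightarrow> ('k, 'm \<Rightarrow> 'm) nualg" where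
  "End_alg sc V = \<lparr>
     acarrier = {f \<in> V \<rightarrow>\<^sub>E V. (\<forall>x\<in>V. \<forall>y\<in>V. f (x + y) = f x + f y) \<and>
                            (\<forall>c. \<forall>x\<in>V. f (sc c x) = sc c (f x))},
     azero = (\<lambda>x\<in>V. 0),
     aadd = (\<lambda>f g. \<lambda>x\<in>V. f x + g x),
     ascale = (\<lambda>c f. \<lambda>x\<in>V. sc c (f x)),
     amult = compose V\<rparr>"

record ('k, 'u, 'm) rep =
  rspace :: "'m set"
  rscale :: "'k \<Rightarrow> 'm \<Rightarrow> 'm"
  ract :: "'u \<Rightarrow> 'm \<Rightarrow> 'm"

definition representation ::
    "('k::field, 'u) nualg \<Rightarrow> ('k, 'u, 'm::ab_group_add) rep \<Rightarrow> bool" where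
  "representation A M \<longleftrightarrow>
     vector_space (rscale M) \<and> module.subspace (rscale M) (rspace M) \<and>
     ract M \<in> alg_hom A (End_alg (rscale M) (rspace M))"

definition subrep ::
    "('k, 'u) nualg \<Rightarrow> ('k, 'u, 'm) rep \<Rightarrow> 'm set \<Rightarrow> ('k, 'u, 'm) rep" where
  "subrep A M W =
     \<lparr>rspace = W, rscale = rscale M, ract = (\<lambda>u\<in>acarrier A. \<lambda>x\<in>W. ract M u x)\<rparr>"

definition rep_iso ::
    "('k, 'u) nualg \<Rightarrow> ('k, 'u, 'm::ab_group_add) rep \<Rightarrow> ('k, 'u, 'n::ab_group_add) rep \<Rightarrow> bool"
  where
  "rep_iso A M N \<longleftrightarrow> (\<exists>\<phi>. bij_betw \<phi> (rspace M) (rspace N) \<and>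
     (\<forall>x\<in>rspace M. \<forall>y\<in>rspace M. \<phi> (x + y) = \<phi> x + \<phi> y) \<and>
     (\<forall>c. \<forall>x\<in>rspace M. \<phi> (rscale M c x) = rscale N c (\<phi> x)) \<and>
     (\<forall>u\<in>acarrier A. \<forall>x\<in>rspace M. \<phi> (ract M u x) = ract N u (\<phi> x)))"


section \<open>Free algebras, ideals, quotients\<close>

datatype 'g free_monoid = Word "'g list"

instantiation free_monoid :: (type) monoid_add
begin

definition zero_free_monoid :: "'a free_monoid" where "0 = Word []"

fun plus_free_monoid :: "'a free_monoid \<Rightarrow> 'a free_monoid \<Rightarrow> 'a free_monoid" where
  "Word v + Word w = Word (v @ w)"

instance
proof
  fix x y z :: "'a free_monoid"
  show "x + y + z = x + (y + z)" by (cases x; cases y; cases z) simp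
  show "0 + x = x" by (cases x) (simp add: zero_free_monoid_def)
  show "x + 0 = x" by (cases x) (simp add: zero_free_monoid_def)
qed

end

text \<open>
  With the convolution product of \<^theory>\<open>HOL-Library.Poly_Mapping\<close> this type is the free unital
  algebra on \<^typ>\<open>'g\<close>; the free algebra without unit on a set \<open>S\<close> consists of the combinations
  of nonempty words in \<open>S\<close>.
\<close>
type_synonym ('g, 'k) free_algebra = "'g free_monoid \<Rightarrow>\<^sub>0 'k"

abbreviation gen :: "'g \<Rightarrow> ('g, 'k::field) free_algebra" where
  "gen g \<equiv> basis_vec (Word [g])"

definition free_alg :: "'g set \<Rightarrow> ('g, 'k::field) free_algebra set" where
  "free_alg S = space_on (Word ` (lists S - {[]}))"

inductive_set ideal_gen ::
    "('g, 'k::field) free_algebra set \<Rightarrow> ('g, 'k) free_algebra set \<Rightarrow> ('g, 'k) free_algebra set"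
  for A R where
  zero: "0 \<in> ideal_gen A R"
| base: "r \<in> R \<Longrightarrow> r \<in> ideal_gen A R"
| add: "x \<in> ideal_gen A R \<Longrightarrow> y \<in> ideal_gen A R \<Longrightarrow> x + y \<in> ideal_gen A R"
| scale: "x \<in> ideal_gen A R \<Longrightarrow> pscale c x \<in> ideal_gen A R"
| left: "f \<in> A \<Longrightarrow> x \<in> ideal_gen A R \<Longrightarrow> f * x \<in> ideal_gen A R"
| right: "x \<in> ideal_gen A R \<Longrightarrow> f \<in> A \<Longrightarrow> x * f \<in> ideal_gen A R"

definition coset :: "'a::ab_group_add set \<Rightarrow> 'a \<Rightarrow> 'a set" where
  "coset I f = (\<lambda>x. f + x) ` I"

definition quotient_alg ::
    "('g, 'k::field) free_algebra set \<Rightarrow> ('g, 'k) free_algebra set \<Rightarrow>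
     ('k, ('g, 'k) free_algebra set) nualg" where
  "quotient_alg A I = \<lparr>
     acarrier = coset I ` A,
     azero = I,
     aadd = (\<lambda>X Y. \<Union>x\<in>X. \<Union>y\<in>Y. coset I (x + y)),
     ascale = (\<lambda>c X. \<Union>x\<in>X. coset I (pscale c x)),
     amult = (\<lambda>X Y. \<Union>x\<in>X. \<Union>y\<in>Y. coset I (x * y))\<rparr>"


section \<open>Leavitt path algebras\<close>

text \<open>
  A quiver is a \<^const>\<open>wf_digraph\<close>: multiple arrows, loops and infinitely many vertices or
  arrows are allowed there.
\<close>

definition sink :: "('v, 'e) pre_digraph \<Rightarrow> 'v \<Rightarrow> bool" where
  "sink Q i \<longleftrightarrow> i \<in> verts Q \<and> out_arcs Q i = {}"

definition regular_vertex :: "('v, 'e) pre_digraph \<Rightarrow> 'v \<Rightarrow> bool" where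
  "regular_vertex Q i \<longleftrightarrow> i \<in> verts Q \<and> \<not> sink Q i \<and> finite (out_arcs Q i)"

datatype ('v, 'e) lpa_gen = Vertex 'v | Arrow 'e | Ghost 'e

definition lpa_gens :: "('v, 'e) pre_digraph \<Rightarrow> ('v, 'e) lpa_gen set" where
  "lpa_gens Q = Vertex ` verts Q \<union> Arrow ` arcs Q \<union> Ghost ` arcs Q"

definition lpa_rels ::
    "('v, 'e) pre_digraph \<Rightarrow> (('v, 'e) lpa_gen, 'k::field) free_algebra set" where
  "lpa_rels Q =
     {gen (Vertex i) * gen (Vertex j) - (if i = j then gen (Vertex i) else 0) | i j.
        i \<in> verts Q \<and> j \<in> verts Q} \<union>
     {gen (Vertex (head Q \<alpha>)) * gen (Arrow \<alpha>) - gen (Arrow \<alpha>) | \<alpha>. \<alpha> \<in> arcs Q} \<union>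
     {gen (Arrow \<alpha>) * gen (Vertex (tail Q \<alpha>)) - gen (Arrow \<alpha>) | \<alpha>. \<alpha> \<in> arcs Q} \<union>
     {gen (Vertex (tail Q \<alpha>)) * gen (Ghost \<alpha>) - gen (Ghost \<alpha>) | \<alpha>. \<alpha> \<in> arcs Q} \<union>
     {gen (Ghost \<alpha>) * gen (Vertex (head Q \<alpha>)) - gen (Ghost \<alpha>) | \<alpha>. \<alpha> \<in> arcs Q} \<union>
     {gen (Arrow \<alpha>) * gen (Ghost \<beta>) - (if \<alpha> = \<beta> then gen (Vertex (head Q \<alpha>)) else 0) | \<alpha> \<beta>.
        \<alpha> \<in> arcs Q \<and> \<beta> \<in> arcs Q} \<union>
     {(\<Sum>\<alpha>\<in>out_arcs Q i. gen (Ghost \<alpha>) * gen (Arrow \<alpha>)) - gen (Vertex i) | i.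
        regular_vertex Q i}"

definition lpa_ideal ::
    "('v, 'e) pre_digraph \<Rightarrow> (('v, 'e) lpa_gen, 'k::field) free_algebra set" where
  "lpa_ideal Q = ideal_gen (free_alg (lpa_gens Q)) (lpa_rels Q)"

definition lpa ::
    "('v, 'e) pre_digraph \<Rightarrow> ('k::field, (('v, 'e) lpa_gen, 'k) free_algebra set) nualg" where
  "lpa Q = quotient_alg (free_alg (lpa_gens Q)) (lpa_ideal Q)"

definition lpa_cls ::
    "('v, 'e) pre_digraph \<Rightarrow> ('v, 'e) lpa_gen \<Rightarrow> (('v, 'e) lpa_gen, 'k::field) free_algebra set"
  where
  "lpa_cls Q g = coset (lpa_ideal Q) (gen g)"

type_synonym ('v, 'e, 'k, 'm) lpa_rep = "('k, (('v, 'e) lpa_gen, 'k) free_algebra set, 'm) rep"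


section \<open>Representations given by an action of the generators on a basis\<close>

text \<open>
  The representation of \<open>L\<^sub>k(Q)\<close> on the space with basis \<open>P\<close> in which each generator \<open>g\<close> sends
  the basis vector \<open>p\<close> to \<open>act g p\<close>.  The action exists and is unique as soon as \<open>act\<close> respects
  the defining relations, see \<open>ract_basis_rep\<close> and \<open>lpa_hom_unique\<close> below; for \<open>\<F>\<close> and
  \<open>\<N>\<close> this is \<open>representation_F_rep\<close> and \<open>representation_N_rep\<close>.
\<close>
definition basis_rep ::
    "('v, 'e) pre_digraph \<Rightarrow> 'p set \<Rightarrow> (('v, 'e) lpa_gen \<Rightarrow> 'p \<Rightarrow> ('p \<Rightarrow>\<^sub>0 'k::field)) \<Rightarrow>
     ('v, 'e, 'k, 'p \<Rightarrow>\<^sub>0 'k) lpa_rep" where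
  "basis_rep Q P act = \<lparr>rspace = space_on P, rscale = pscale,
     ract = (THE \<rho>. \<rho> \<in> alg_hom (lpa Q) (End_alg pscale (space_on P)) \<and>
       (\<forall>g\<in>lpa_gens Q. \<forall>p\<in>P. \<rho> (lpa_cls Q g) (basis_vec p) = act g p))\<rparr>"


section \<open>Left-infinite paths and the representations \<open>\<F>\<close>\<close>

text \<open>
  Paths are recorded in the order in which their arrows are traversed: the left-infinite path
  \<open>\<cdots>\<alpha>\<^sub>3\<alpha>\<^sub>2\<alpha>\<^sub>1\<close> is the stream \<open>\<alpha>\<^sub>1, \<alpha>\<^sub>2, \<alpha>\<^sub>3, \<dots>\<close>, and the finite path \<open>\<alpha>\<^sub>n\<cdots>\<alpha>\<^sub>1\<close> is the
  list \<open>[\<alpha>\<^sub>1, \<dots>, \<alpha>\<^sub>n]\<close>.  So \<open>\<tau>\<^bsub>>n\<^esub>\<close> is \<^term>\<open>sdrop n\<close>, \<open>p\<alpha>\<close> is \<open>\<alpha> ## p\<close>, and \<open>q\<^sup>\<infinity>\<close> is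
  \<^term>\<open>cycle q\<close> from \<^theory>\<open>HOL-Library.Stream\<close>.
\<close>

definition inf_paths :: "('v, 'e) pre_digraph \<Rightarrow> 'e stream set" where
  "inf_paths Q = {p \<in> streams (arcs Q). \<forall>n. head Q (p !! n) = tail Q (p !! Suc n)}"

definition tail_equiv :: "('v, 'e) pre_digraph \<Rightarrow> 'e stream rel" where
  "tail_equiv Q =
     {(p, q). p \<in> inf_paths Q \<and> q \<in> inf_paths Q \<and> (\<exists>n m. sdrop n p = sdrop m q)}"

definition tail_class :: "('v, 'e) pre_digraph \<Rightarrow> 'e stream \<Rightarrow> 'e stream set" where
  "tail_class Q p = tail_equiv Q `` {p}"

definition oriented_cycle :: "('v, 'e) pre_digraph \<Rightarrow> 'e list \<Rightarrow> bool" where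
  "oriented_cycle Q q \<longleftrightarrow> q \<noteq> [] \<and> (\<exists>i. pre_digraph.awalk Q i q i)"

definition simple_cycle :: "('v, 'e) pre_digraph \<Rightarrow> 'e list \<Rightarrow> bool" where
  "simple_cycle Q q \<longleftrightarrow> oriented_cycle Q q \<and>
     \<not> (\<exists>c m. oriented_cycle Q c \<and> length c < length q \<and> q = concat (replicate m c))"

definition rational_path :: "('v, 'e) pre_digraph \<Rightarrow> 'e stream \<Rightarrow> bool" where
  "rational_path Q p \<longleftrightarrow> (\<exists>q. oriented_cycle Q q \<and> (p, cycle q) \<in> tail_equiv Q)"

definition irrational_path :: "('v, 'e) pre_digraph \<Rightarrow> 'e stream \<Rightarrow> bool" where
  "irrational_path Q p \<longleftrightarrow> p \<in> inf_paths Q \<and> \<not> rational_path Q p"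

fun F_act ::
    "('v, 'e) pre_digraph \<Rightarrow> ('v, 'e) lpa_gen \<Rightarrow> 'e stream \<Rightarrow> ('e stream \<Rightarrow>\<^sub>0 'k::field)" where
  "F_act Q (Vertex i) p = (if i = tail Q (shd p) then basis_vec p else 0)"
| "F_act Q (Arrow \<alpha>) p = (if \<alpha> = shd p then basis_vec (sdrop 1 p) else 0)"
| "F_act Q (Ghost \<alpha>) p = (if head Q \<alpha> = tail Q (shd p) then basis_vec (\<alpha> ## p) else 0)"

definition F_rep :: "('v, 'e) pre_digraph \<Rightarrow> ('v, 'e, 'k::field, 'e stream \<Rightarrow>\<^sub>0 'k) lpa_rep" where
  "F_rep Q = basis_rep Q (inf_paths Q) (F_act Q)"

definition F_class ::
    "('v, 'e) pre_digraph \<Rightarrow> 'e stream set \<Rightarrow> ('v, 'e, 'k::field, 'e stream \<Rightarrow>\<^sub>0 'k) lpa_rep" where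
  "F_class Q C = subrep (lpa Q) (F_rep Q) (pscale.span (basis_vec ` C))"


section \<open>Finite paths ending at a sink and the representations \<open>\<N>\<close>\<close>

text \<open>
  A finite path is a pair of its starting vertex and its list of arrows, so that
  \<open>(i, [])\<close> is the trivial path \<open>e\<^sub>i\<close>.
\<close>

definition sink_paths_to :: "('v, 'e) pre_digraph \<Rightarrow> 'v \<Rightarrow> ('v \<times> 'e list) set" where
  "sink_paths_to Q i = {(u, xs). sink Q i \<and> pre_digraph.awalk Q u xs i}"

definition sink_paths :: "('v, 'e) pre_digraph \<Rightarrow> ('v \<times> 'e list) set" where
  "sink_paths Q = (\<Union>i. sink_paths_to Q i)"

fun N_act ::
    "('v, 'e) pre_digraph \<Rightarrow> ('v, 'e) lpa_gen \<Rightarrow> 'v \<times> 'e list \<Rightarrow> ('v \<times> 'e list \<Rightarrow>\<^sub>0 'k::field)"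
  where
  "N_act Q (Vertex i) (u, xs) = (if i = u then basis_vec (u, xs) else 0)"
| "N_act Q (Arrow \<alpha>) (u, []) = 0"
| "N_act Q (Arrow \<alpha>) (u, x # xs) = (if \<alpha> = x then basis_vec (head Q \<alpha>, xs) else 0)"
| "N_act Q (Ghost \<alpha>) (u, xs) = (if head Q \<alpha> = u then basis_vec (tail Q \<alpha>, \<alpha> # xs) else 0)"

definition N_rep :: "('v, 'e) pre_digraph \<Rightarrow> ('v, 'e, 'k::field, 'v \<times> 'e list \<Rightarrow>\<^sub>0 'k) lpa_rep" where
  "N_rep Q = basis_rep Q (sink_paths Q) (N_act Q)"

definition N_sink ::
    "('v, 'e) pre_digraph \<Rightarrow> 'v \<Rightarrow> ('v, 'e, 'k::field, 'v \<times> 'e list \<Rightarrow>\<^sub>0 'k) lpa_rep" where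
  "N_sink Q i = subrep (lpa Q) (N_rep Q) (pscale.span (basis_vec ` sink_paths_to Q i))"


section \<open>Twisting\<close>

text \<open>An element of \<open>(k\<^sup>\<times>)\<^bsup>Q\<^sub>1\<^esup>\<close> is a function on arrows; only its values on \<open>Q\<^sub>1\<close> matter.\<close>
definition weights :: "('v, 'e) pre_digraph \<Rightarrow> ('e \<Rightarrow> 'k::field) set" where
  "weights Q = arcs Q \<rightarrow> {x. x \<noteq> 0}"

text \<open>Existence and uniqueness of \<open>\<gamma>\<^sub>a\<close>, and its bijectivity: \<open>twist_aut\<close>, \<open>twist_aut_bij\<close> below.\<close>
definition twist_aut ::
    "('v, 'e) pre_digraph \<Rightarrow> ('e \<Rightarrow> 'k::field) \<Rightarrow>
     (('v, 'e) lpa_gen, 'k) free_algebra set \<Rightarrow> (('v, 'e) lpa_gen, 'k) free_algebra set" where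
  "twist_aut Q a = (THE \<gamma>. \<gamma> \<in> alg_hom (lpa Q) (lpa Q) \<and>
     (\<forall>i\<in>verts Q. \<gamma> (lpa_cls Q (Vertex i)) = lpa_cls Q (Vertex i)) \<and>
     (\<forall>\<alpha>\<in>arcs Q. \<gamma> (lpa_cls Q (Arrow \<alpha>)) = ascale (lpa Q) (a \<alpha>) (lpa_cls Q (Arrow \<alpha>)) \<and>
       \<gamma> (lpa_cls Q (Ghost \<alpha>)) = ascale (lpa Q) (inverse (a \<alpha>)) (lpa_cls Q (Ghost \<alpha>))))"

definition twist ::
    "('v, 'e) pre_digraph \<Rightarrow> ('e \<Rightarrow> 'k::field) \<Rightarrow>
     ('v, 'e, 'k, 'm::ab_group_add) lpa_rep \<Rightarrow> ('v, 'e, 'k, 'm) lpa_rep" where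
  "twist Q a M = M\<lparr>ract := \<lambda>u\<in>acarrier (lpa Q). ract M (twist_aut Q a u)\<rparr>"

definition path_stable :: "('e \<Rightarrow> 'k::field) \<Rightarrow> 'e list \<Rightarrow> bool" where
  "path_stable a p \<longleftrightarrow> prod_list (map a p) = 1"


section \<open>The constructions are well defined\<close>

subsection \<open>Quotients by ideals, the universal property of \<open>L\<^sub>k(Q)\<close>\<close>

lemma pscale_conv_mult: "pscale c f = Poly_Mapping.single 0 c * f" for f :: "('g, 'k::field) free_algebra"
  unfolding pscale_def by (simp add: mult_map_scale_conv_mult)

lemma pscale_single [simp]: "pscale c (Poly_Mapping.single p d) = Poly_Mapping.single p (c * d)"
  by (auto intro!: poly_mapping_eqI simp: lookup_single when_def)

lemma keys_pscale: "Poly_Mapping.keys (pscale c f) \<subseteq> Poly_Mapping.keys f"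
  by (auto simp: in_keys_iff)

lemma subspace_space_on: "pscale.subspace (space_on P)"
  unfolding pscale.subspace_def space_on_def
  by (auto dest!: subsetD[OF keys_pscale] subsetD[OF Poly_Mapping.keys_add])

lemma single_in_space_on: "p \<in> P \<Longrightarrow> Poly_Mapping.single p c \<in> space_on P"
  by (auto simp: space_on_def)

lemma pm_decomp: "f = (\<Sum>p\<in>Poly_Mapping.keys f. Poly_Mapping.single p (Poly_Mapping.lookup f p))"
  by (auto intro!: poly_mapping_eqI simp: lookup_sum lookup_single when_def in_keys_iff)

lemma space_on_induct [consumes 1, case_names zero single add]:
  assumes f: "f \<in> space_on P"
    and "Q 0" and s: "\<And>p c. p \<in> P \<Longrightarrow> Q (Poly_Mapping.single p c)"
    and a: "\<And>f g. f \<in> space_on P \<Longrightarrow> g \<in> space_on P \<Longrightarrow> Q f \<Longrightarrow> Q g \<Longrightarrow> Q (f + g)"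
  shows "Q f"
proof -
  have "Q (\<Sum>p\<in>X. Poly_Mapping.single p (Poly_Mapping.lookup f p)) \<and>
     (\<Sum>p\<in>X. Poly_Mapping.single p (Poly_Mapping.lookup f p)) \<in> space_on P"
    if "finite X" "X \<subseteq> P" for X
    using that
  proof (induction X)
    case (insert x X)
    then have "Poly_Mapping.single x (Poly_Mapping.lookup f x) \<in> space_on P"
      by (intro single_in_space_on) auto
    with insert show ?case
      by (auto intro!: a s pscale.subspace_add[OF subspace_space_on])
  qed (auto intro!: assms pscale.subspace_0[OF subspace_space_on])
  from this[of "Poly_Mapping.keys f"] f pm_decomp[of f] show ?thesis
    by (auto simp: space_on_def)
qed

lemma space_on_UNIV: "f \<in> space_on UNIV" by (simp add: space_on_def)

lemma pscale_mult_left: "pscale c f * g = pscale c (f * g)"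
  for f g :: "('g, 'k::field) free_algebra"
  by (simp add: pscale_conv_mult mult.assoc)

lemma pscale_mult_right: "f * pscale c g = pscale c (f * g)"
  for f g :: "('g, 'k::field) free_algebra"
proof -
  have "f * Poly_Mapping.single 0 c = Poly_Mapping.single 0 c * f"
    using space_on_UNIV[of f]
    by (induction f rule: space_on_induct) (auto simp: mult_single algebra_simps)
  then show ?thesis by (metis pscale_conv_mult mult.assoc)
qed

lemma span_basis: "pscale.span (basis_vec ` P) = space_on P"
proof
  show "pscale.span (basis_vec ` P) \<subseteq> space_on P"
    by (rule pscale.span_minimal) (auto simp: subspace_space_on single_in_space_on)
  show "space_on P \<subseteq> pscale.span (basis_vec ` P)"
  proof
    fix f assume "f \<in> space_on P"
    then show "f \<in> pscale.span (basis_vec ` P)"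
    proof (induction f rule: space_on_induct)
      case (single p c)
      have "pscale c (basis_vec p) \<in> pscale.span (basis_vec ` P)"
        using single by (intro pscale.span_scale pscale.span_base) auto
      then show ?case by simp
    qed (auto intro: pscale.span_add pscale.span_zero)
  qed
qed

locale alg_ideal =
  fixes A I :: "('g, 'k::field) free_algebra set"
  assumes A: "pscale.subspace A" and I: "pscale.subspace I" and IA: "I \<subseteq> A"
    and AA: "\<And>f g. f \<in> A \<Longrightarrow> g \<in> A \<Longrightarrow> f * g \<in> A"
    and AI: "\<And>f g. f \<in> A \<Longrightarrow> g \<in> I \<Longrightarrow> f * g \<in> I" "\<And>f g. f \<in> I \<Longrightarrow> g \<in> A \<Longrightarrow> f * g \<in> I"
begin

lemma mem_coset: "g \<in> coset I f \<longleftrightarrow> g - f \<in> I"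
  unfolding coset_def by (auto intro: rev_image_eqI)

lemma coset_eq: "coset I f = coset I g \<longleftrightarrow> f - g \<in> I"
proof
  assume "coset I f = coset I g"
  moreover have "f \<in> coset I f" using mem_coset I pscale.subspace_0 by fastforce
  ultimately show "f - g \<in> I" using mem_coset by blast
next
  assume "f - g \<in> I"
  then have "h - f \<in> I \<longleftrightarrow> h - g \<in> I" for h
    using pscale.subspace_add[OF I, of "h - f" "f - g"]
      pscale.subspace_diff[OF I, of "h - g" "f - g"] by auto
  then show "coset I f = coset I g" by (auto simp: mem_coset)
qed

lemma zero_eq: "azero (quotient_alg A I) = coset I 0"
  by (simp add: quotient_alg_def coset_def)

lemma self_coset: "f \<in> coset I f" using mem_coset I pscale.subspace_0 by fastforce

lemma add_eq: "aadd (quotient_alg A I) (coset I f) (coset I g) = coset I (f + g)"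
proof -
  have "coset I (x + y) = coset I (f + g)" if "x \<in> coset I f" "y \<in> coset I g" for x y
    using that pscale.subspace_add[OF I, of "x - f" "y - g"]
    by (simp add: coset_eq mem_coset algebra_simps)
  then have "(\<Union>x\<in>coset I f. \<Union>y\<in>coset I g. coset I (x + y)) =
      (\<Union>x\<in>coset I f. \<Union>y\<in>coset I g. coset I (f + g))"
    by (intro SUP_cong refl)
  also have "\<dots> = coset I (f + g)" using self_coset[of f] self_coset[of g] by blast
  finally show ?thesis by (simp add: quotient_alg_def)
qed

lemma scale_eq: "ascale (quotient_alg A I) c (coset I f) = coset I (pscale c f)"
proof -
  have "coset I (pscale c x) = coset I (pscale c f)" if "x \<in> coset I f" for x
    using that pscale.subspace_scale[OF I, of "x - f" c]
    by (simp add: coset_eq mem_coset pscale.scale_right_diff_distrib)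
  then have "(\<Union>x\<in>coset I f. coset I (pscale c x)) = (\<Union>x\<in>coset I f. coset I (pscale c f))"
    by (intro SUP_cong refl)
  also have "\<dots> = coset I (pscale c f)" using self_coset[of f] by blast
  finally show ?thesis by (simp add: quotient_alg_def)
qed

lemma mult_eq:
  assumes "f \<in> A" "g \<in> A"
  shows "amult (quotient_alg A I) (coset I f) (coset I g) = coset I (f * g)"
proof -
  have "coset I (x * y) = coset I (f * g)" if "x \<in> coset I f" "y \<in> coset I g" for x y
  proof -
    have "y - g + g \<in> A" using that IA A assms by (intro pscale.subspace_add) (auto simp: mem_coset)
    then have "(x - f) * y + f * (y - g) \<in> I"
      using that assms IA by (intro pscale.subspace_add I AI) (auto simp: mem_coset)
    then show ?thesis by (simp add: coset_eq algebra_simps)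
  qed
  then have "(\<Union>x\<in>coset I f. \<Union>y\<in>coset I g. coset I (x * y)) =
      (\<Union>x\<in>coset I f. \<Union>y\<in>coset I g. coset I (f * g))"
    by (intro SUP_cong refl)
  also have "\<dots> = coset I (f * g)" using self_coset[of f] self_coset[of g] by blast
  finally show ?thesis by (simp add: quotient_alg_def)
qed

lemma carrier_eq: "acarrier (quotient_alg A I) = coset I ` A"
  by (simp add: quotient_alg_def)

lemma lift:
  assumes H: "\<And>f. f \<in> A \<Longrightarrow> H f \<in> acarrier B" and H0: "H 0 = azero B"
    and Ha: "\<And>f g. f \<in> A \<Longrightarrow> g \<in> A \<Longrightarrow> H (f + g) = aadd B (H f) (H g)"
    and Hs: "\<And>c f. f \<in> A \<Longrightarrow> H (pscale c f) = ascale B c (H f)"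
    and Hm: "\<And>f g. f \<in> A \<Longrightarrow> g \<in> A \<Longrightarrow> H (f * g) = amult B (H f) (H g)"
    and Hi: "\<And>f g. f \<in> A \<Longrightarrow> g \<in> A \<Longrightarrow> f - g \<in> I \<Longrightarrow> H f = H g"
  shows "\<exists>h \<in> alg_hom (quotient_alg A I) B. \<forall>f\<in>A. h (coset I f) = H f"
proof -
  define h where "h = (\<lambda>X\<in>coset I ` A. H (SOME f. f \<in> A \<and> X = coset I f))"
  have h: "h (coset I f) = H f" if "f \<in> A" for f
  proof -
    have "(SOME g. g \<in> A \<and> coset I f = coset I g) \<in> A \<and>
       coset I f = coset I (SOME g. g \<in> A \<and> coset I f = coset I g)"
      using that by (intro someI[of "\<lambda>g. g \<in> A \<and> coset I f = coset I g"]) auto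
    then show ?thesis using that Hi coset_eq by (auto simp: h_def)
  qed
  have "h \<in> alg_hom (quotient_alg A I) B"
    unfolding alg_hom_def carrier_eq
    using h H H0 Ha Hs Hm A AA
    by (auto simp: add_eq scale_eq mult_eq zero_eq pscale.subspace_add pscale.subspace_scale
          pscale.subspace_0 intro: restrictI) (auto simp: h_def)
  with h show ?thesis by blast
qed

end

lemma free_alg_mult: "f \<in> free_alg S \<Longrightarrow> g \<in> free_alg S \<Longrightarrow> f * g \<in> free_alg S"
proof -
  assume "f \<in> free_alg S" "g \<in> free_alg S"
  then show ?thesis
    using keys_mult[of f g] unfolding free_alg_def space_on_def by fastforce
qed

lemma subspace_free_alg: "pscale.subspace (free_alg S)"
  unfolding free_alg_def by (rule subspace_space_on)

lemma gen_in_free_alg: "g \<in> S \<Longrightarrow> gen g \<in> free_alg S"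
  unfolding free_alg_def by (rule single_in_space_on) auto

lemma ideal_gen_subset:
  assumes "R \<subseteq> free_alg S" "x \<in> ideal_gen (free_alg S) R"
  shows "x \<in> free_alg S"
  using assms(2)
proof (induction)
  case zero show ?case by (rule pscale.subspace_0[OF subspace_free_alg])
next
  case (base r) then show ?case using assms(1) by auto
next
  case (add x y) then show ?case by (intro pscale.subspace_add[OF subspace_free_alg])
next
  case (scale x c) then show ?case by (intro pscale.subspace_scale[OF subspace_free_alg])
qed (auto intro: free_alg_mult)

lemma alg_ideal_gen: "R \<subseteq> free_alg S \<Longrightarrow> alg_ideal (free_alg S) (ideal_gen (free_alg S) R)"
  by (rule alg_ideal.intro[OF subspace_free_alg])
    (auto intro: ideal_gen.intros free_alg_mult ideal_gen_subset simp: pscale.subspace_def)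

lemma lpa_rels_subset:
  assumes "wf_digraph Q"
  shows "lpa_rels Q \<subseteq> free_alg (lpa_gens Q)"
proof -
  interpret wf_digraph Q by fact
  note sub = subspace_free_alg[of "lpa_gens Q"]
  have g: "i \<in> verts Q \<Longrightarrow> gen (Vertex i) \<in> free_alg (lpa_gens Q)"
    "\<alpha> \<in> arcs Q \<Longrightarrow> gen (Arrow \<alpha>) \<in> free_alg (lpa_gens Q)"
    "\<alpha> \<in> arcs Q \<Longrightarrow> gen (Ghost \<alpha>) \<in> free_alg (lpa_gens Q)" for i \<alpha>
    by (auto intro!: gen_in_free_alg simp: lpa_gens_def)
  show ?thesis
    unfolding lpa_rels_def
    by (auto intro!: pscale.subspace_diff[OF sub] pscale.subspace_sum[OF sub] free_alg_mult g
         pscale.subspace_0[OF sub] simp: regular_vertex_def simp del: mult_single)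
qed

lemma alg_ideal_lpa: "wf_digraph Q \<Longrightarrow> alg_ideal (free_alg (lpa_gens Q)) (lpa_ideal Q)"
  unfolding lpa_ideal_def by (intro alg_ideal_gen lpa_rels_subset)

lemma lpa_hom_unique:
  fixes h h' :: "(('v, 'e) lpa_gen, 'k::field) free_algebra set \<Rightarrow> 'b"
  assumes Q: "wf_digraph Q"
    and h: "h \<in> alg_hom (lpa Q) B" and h': "h' \<in> alg_hom (lpa Q) B"
    and eq: "\<And>g. g \<in> lpa_gens Q \<Longrightarrow> h (lpa_cls Q g) = h' (lpa_cls Q g)"
  shows "h = h'"
proof -
  interpret alg_ideal "free_alg (lpa_gens Q)"
    "lpa_ideal Q :: (('v, 'e) lpa_gen, 'k) free_algebra set" by (rule alg_ideal_lpa[OF Q])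
  let ?A = "free_alg (lpa_gens Q) :: (('v, 'e) lpa_gen, 'k) free_algebra set"
  let ?c = "coset (lpa_ideal Q) :: _ \<Rightarrow> (('v, 'e) lpa_gen, 'k) free_algebra set"
  note hd = h[unfolded alg_hom_def lpa_def carrier_eq, simplified]
  note hd' = h'[unfolded alg_hom_def lpa_def carrier_eq, simplified]
  have w: "h (?c (basis_vec (Word w))) = h' (?c (basis_vec (Word w)))"
    if "w \<noteq> []" "w \<in> lists (lpa_gens Q)" for w
    using that
  proof (induction w rule: list_nonempty_induct)
    case (single x) then show ?case using eq[of x] by (auto simp: lpa_cls_def)
  next
    case (cons x w)
    have m: "gen x \<in> ?A" "basis_vec (Word w) \<in> ?A"
      using cons by (auto intro!: single_in_space_on simp: free_alg_def)
    have "?c (basis_vec (Word (x # w))) = amult (quotient_alg ?A (lpa_ideal Q)) (?c (gen x)) (?c (basis_vec (Word w)))"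
      using m by (simp add: mult_eq mult_single)
    with m show ?case using hd hd' cons eq[of x] by (auto simp: lpa_cls_def)
  qed
  have *: "h (?c f) = h' (?c f)" if "f \<in> ?A" for f
    using that unfolding free_alg_def
  proof (induction f rule: space_on_induct)
    case zero then show ?case using hd hd' zero_eq by auto
  next
    case (single p c)
    then obtain w where w': "p = Word w" "w \<noteq> []" "w \<in> lists (lpa_gens Q)" by auto
    have m: "basis_vec p \<in> ?A" using single by (auto intro!: single_in_space_on simp: free_alg_def)
    have "?c (Poly_Mapping.single p c) = ascale (quotient_alg ?A (lpa_ideal Q)) c (?c (basis_vec p))"
      by (simp add: scale_eq)
    with m show ?case using hd hd' w w' by auto
  next
    case (add f g)
    have "?c (f + g) = aadd (quotient_alg ?A (lpa_ideal Q)) (?c f) (?c g)" by (simp add: add_eq)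
    then show ?case using hd hd' add unfolding free_alg_def[symmetric] by auto
  qed
  show ?thesis
    using hd hd' * by (intro PiE_ext[of h "?c ` ?A" "\<lambda>_. acarrier B" h']) auto
qed


subsection \<open>Existence of the representations\<close>

definition lin :: "('p \<Rightarrow> ('q \<Rightarrow>\<^sub>0 'k)) \<Rightarrow> ('p \<Rightarrow>\<^sub>0 'k::field) \<Rightarrow> ('q \<Rightarrow>\<^sub>0 'k)" where
  "lin \<phi> f = (\<Sum>p\<in>Poly_Mapping.keys f. pscale (Poly_Mapping.lookup f p) (\<phi> p))"

lemma lin_superset:
  assumes "finite X" "Poly_Mapping.keys f \<subseteq> X"
  shows "lin \<phi> f = (\<Sum>p\<in>X. pscale (Poly_Mapping.lookup f p) (\<phi> p))"
  unfolding lin_def using assms by (intro sum.mono_neutral_left) (auto simp: in_keys_iff)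

lemma lin_add: "lin \<phi> (f + g) = lin \<phi> f + lin \<phi> g"
proof -
  let ?X = "Poly_Mapping.keys f \<union> Poly_Mapping.keys g"
  have "lin \<phi> (f + g) = (\<Sum>p\<in>?X. pscale (Poly_Mapping.lookup (f + g) p) (\<phi> p))"
    by (intro lin_superset Poly_Mapping.keys_add) auto
  also have "\<dots> = (\<Sum>p\<in>?X. pscale (Poly_Mapping.lookup f p) (\<phi> p)) +
      (\<Sum>p\<in>?X. pscale (Poly_Mapping.lookup g p) (\<phi> p))"
    by (simp add: lookup_add pscale.scale_left_distrib sum.distrib)
  also have "\<dots> = lin \<phi> f + lin \<phi> g"
    by (subst (1 2) lin_superset[of ?X]) auto
  finally show ?thesis .
qed

lemma lin_scale: "lin \<phi> (pscale c f) = pscale c (lin \<phi> f)"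
proof -
  have "lin \<phi> (pscale c f) = (\<Sum>p\<in>Poly_Mapping.keys f. pscale (c * Poly_Mapping.lookup f p) (\<phi> p))"
    by (subst lin_superset[OF _ keys_pscale]) auto
  then show ?thesis by (simp add: lin_def pscale.scale_sum_right)
qed

lemma lin_single [simp]: "lin \<phi> (Poly_Mapping.single p c) = pscale c (\<phi> p)"
  by (simp add: lin_def)

lemma lin_0 [simp]: "lin \<phi> 0 = 0"
  by (simp add: lin_def)

lemma lin_in:
  assumes "pscale.subspace W" "f \<in> space_on P" "\<And>p. p \<in> P \<Longrightarrow> \<phi> p \<in> W"
  shows "lin \<phi> f \<in> W"
  unfolding lin_def using assms
  by (intro pscale.subspace_sum pscale.subspace_scale) (auto simp: space_on_def)

lemma lin_fun_add: "lin (\<lambda>p. \<phi> p + \<psi> p) f = lin \<phi> f + lin \<psi> f"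
  by (simp add: lin_def pscale.scale_right_distrib sum.distrib)

lemma lin_fun_scale: "lin (\<lambda>p. pscale c (\<phi> p)) f = pscale c (lin \<phi> f)"
  by (simp add: lin_def pscale.scale_sum_right mult.commute)

fun wop :: "('g \<Rightarrow> 'p \<Rightarrow> ('p \<Rightarrow>\<^sub>0 'k::field)) \<Rightarrow> 'g free_monoid \<Rightarrow> ('p \<Rightarrow>\<^sub>0 'k) \<Rightarrow> ('p \<Rightarrow>\<^sub>0 'k)" where
  "wop act (Word w) x = foldr (\<lambda>g. lin (act g)) w x"

definition rho ::
    "('g \<Rightarrow> 'p \<Rightarrow> ('p \<Rightarrow>\<^sub>0 'k::field)) \<Rightarrow> ('g, 'k) free_algebra \<Rightarrow> ('p \<Rightarrow>\<^sub>0 'k) \<Rightarrow> ('p \<Rightarrow>\<^sub>0 'k)" where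
  "rho act f x = lin (\<lambda>w. wop act w x) f"

lemma wop_add: "wop act w (x + y) = wop act w x + wop act w y"
proof (cases w)
  case (Word l)
  have "foldr (\<lambda>g. lin (act g)) l (x + y) = foldr (\<lambda>g. lin (act g)) l x + foldr (\<lambda>g. lin (act g)) l y"
    by (induction l) (auto simp: lin_add)
  with Word show ?thesis by simp
qed

lemma wop_scale: "wop act w (pscale c x) = pscale c (wop act w x)"
proof (cases w)
  case (Word l)
  have "foldr (\<lambda>g. lin (act g)) l (pscale c x) = pscale c (foldr (\<lambda>g. lin (act g)) l x)"
    by (induction l) (auto simp: lin_scale)
  with Word show ?thesis by simp
qed

lemma wop_mult: "wop act (v + w) x = wop act v (wop act w x)"
  by (cases v; cases w) simp

lemma rho_add: "rho act (f + g) x = rho act f x + rho act g x"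
  and rho_scale: "rho act (pscale c f) x = pscale c (rho act f x)"
  and rho_0 [simp]: "rho act 0 x = 0"
  by (auto simp: rho_def lin_add lin_scale)

lemma rho_arg_add: "rho act f (x + y) = rho act f x + rho act f y"
  and rho_arg_scale: "rho act f (pscale c x) = pscale c (rho act f x)"
  by (simp_all add: rho_def wop_add wop_scale lin_fun_add lin_fun_scale)

lemma rho_arg_0 [simp]: "rho act f 0 = 0"
  using rho_arg_scale[of act f 0 0] by simp

lemma rho_diff: "rho act (f - g) x = rho act f x - rho act g x"
  using rho_add[of act "f - g" g x] by simp

lemma rho_sum: "rho act (sum F X) x = (\<Sum>a\<in>X. rho act (F a) x)"
  by (induction X rule: infinite_finite_induct) (auto simp: rho_add)

lemma rho_single: "rho act (Poly_Mapping.single w c) x = pscale c (wop act w x)"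
  by (simp add: rho_def)

lemma rho_mult: "rho act (f * g) x = rho act f (rho act g x)"
  using space_on_UNIV[of f]
proof (induction f rule: space_on_induct)
  case (single v c)
  show ?case using space_on_UNIV[of g]
  proof (induction g rule: space_on_induct)
    case (single w d)
    show ?case by (simp add: mult_single rho_single wop_mult wop_scale)
  qed (simp_all add: algebra_simps rho_add rho_arg_add)
qed (simp_all add: algebra_simps rho_add)

lemma rho_gen [simp]: "rho act (gen g) x = lin (act g) x"
  by (simp add: rho_single)

context
  fixes Q :: "('v, 'e) pre_digraph" and P :: "'p set"
    and act :: "('v, 'e) lpa_gen \<Rightarrow> 'p \<Rightarrow> ('p \<Rightarrow>\<^sub>0 'k::field)"
  assumes Q: "wf_digraph Q"
    and actP: "\<And>g p. g \<in> lpa_gens Q \<Longrightarrow> p \<in> P \<Longrightarrow> act g p \<in> space_on P"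
begin

lemma rho_space:
  assumes f: "f \<in> free_alg (lpa_gens Q)" and x: "x \<in> space_on P"
  shows "rho act f x \<in> space_on P"
proof -
  have "foldr (\<lambda>g. lin (act g)) l x \<in> space_on P" if "\<forall>g\<in>set l. g \<in> lpa_gens Q" for l
    using that by (induction l) (auto intro!: x lin_in[OF subspace_space_on] actP)
  then show ?thesis unfolding rho_def
    by (intro lin_in[OF subspace_space_on f[unfolded free_alg_def]]) auto
qed

lemma ract_basis_rep:
  assumes rel: "\<And>r p. r \<in> lpa_rels Q \<Longrightarrow> p \<in> P \<Longrightarrow> rho act r (basis_vec p) = 0"
  shows "ract (basis_rep Q P act) \<in> alg_hom (lpa Q) (End_alg pscale (space_on P))"
    and "\<And>g p. g \<in> lpa_gens Q \<Longrightarrow> p \<in> P \<Longrightarrow> ract (basis_rep Q P act) (lpa_cls Q g) (basis_vec p) = act g p"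
    and "\<And>f x. f \<in> free_alg (lpa_gens Q) \<Longrightarrow> x \<in> space_on P \<Longrightarrow>
      ract (basis_rep Q P act) (coset (lpa_ideal Q) f) x = rho act f x"
proof -
  let ?V = "space_on P :: ('p \<Rightarrow>\<^sub>0 'k) set"
  let ?A = "free_alg (lpa_gens Q) :: (('v, 'e) lpa_gen, 'k) free_algebra set"
  interpret alg_ideal ?A "lpa_ideal Q" by (rule alg_ideal_lpa[OF Q])
  have ideal: "rho act f x = 0" if "f \<in> lpa_ideal Q" "x \<in> ?V" for f x
    using that unfolding lpa_ideal_def
  proof (induction f arbitrary: x)
    case (base r)
    from base(2) show ?case
    proof (induction x rule: space_on_induct)
      case (single p c)
      have "rho act r (pscale c (basis_vec p)) = 0"
        using rel[OF base(1) single] by (simp add: rho_arg_scale del: pscale_single)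
      then show ?case by simp
    qed (auto simp: rho_arg_add)
  qed (auto simp: rho_add rho_scale rho_mult intro: rho_space)
  define H where "H f = (\<lambda>x\<in>?V. rho act f x)" for f
  have "\<exists>h\<in>alg_hom (quotient_alg ?A (lpa_ideal Q)) (End_alg pscale ?V).
      \<forall>f\<in>?A. h (coset (lpa_ideal Q) f) = H f"
  proof (rule lift)
    fix f :: "(('v, 'e) lpa_gen, 'k) free_algebra" assume "f \<in> ?A"
    then show "H f \<in> acarrier (End_alg pscale ?V)"
      using rho_space
      by (auto simp: H_def End_alg_def rho_arg_add rho_arg_scale
          pscale.subspace_add[OF subspace_space_on] pscale.subspace_scale[OF subspace_space_on])
  next
    fix f g :: "(('v, 'e) lpa_gen, 'k) free_algebra" assume fg: "f \<in> ?A" "g \<in> ?A"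
    show "H (f * g) = amult (End_alg pscale ?V) (H f) (H g)"
      using rho_space fg by (auto simp: H_def End_alg_def compose_def rho_mult fun_eq_iff restrict_def)
    assume "f - g \<in> lpa_ideal Q"
    then show "H f = H g"
      using ideal[of "f - g"] by (auto simp: H_def rho_diff fun_eq_iff restrict_def)
  qed (auto simp: H_def End_alg_def rho_add rho_scale)
  then obtain h where h: "h \<in> alg_hom (lpa Q) (End_alg pscale ?V)"
      "\<And>f. f \<in> ?A \<Longrightarrow> h (coset (lpa_ideal Q) f) = H f"
    by (auto simp: lpa_def)
  have hg: "h (lpa_cls Q g) (basis_vec p) = act g p" if "g \<in> lpa_gens Q" "p \<in> P" for g p
    using that h(2)[OF gen_in_free_alg[of g]]
    by (simp add: lpa_cls_def H_def single_in_space_on)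
  have "ract (basis_rep Q P act) = h"
    unfolding basis_rep_def rep.simps
  proof (rule the_equality)
    fix h' assume h': "h' \<in> alg_hom (lpa Q) (End_alg pscale ?V) \<and>
      (\<forall>g\<in>lpa_gens Q. \<forall>p\<in>P. h' (lpa_cls Q g) (basis_vec p) = act g p)"
    show "h' = h"
    proof (rule lpa_hom_unique[OF Q])
      fix g assume g: "g \<in> lpa_gens Q"
      then have "(lpa_cls Q g :: (('v, 'e) lpa_gen, 'k) free_algebra set) \<in> acarrier (lpa Q)"
        by (auto simp: lpa_cls_def lpa_def carrier_eq intro: gen_in_free_alg)
      then have E: "h' (lpa_cls Q g) \<in> acarrier (End_alg pscale ?V)"
        "h (lpa_cls Q g) \<in> acarrier (End_alg pscale ?V)"
        using h(1) h' by (auto simp: alg_hom_def)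
      have "h' (lpa_cls Q g) x = h (lpa_cls Q g) x" if "x \<in> ?V" for x
        using that
      proof (induction x rule: space_on_induct)
        case zero
        have "0 \<in> ?V" by (rule pscale.subspace_0[OF subspace_space_on])
        then have "h' (lpa_cls Q g) (pscale 0 0) = h (lpa_cls Q g) (pscale 0 0)"
          using E by (simp add: End_alg_def del: pscale.scale_zero_left pscale.scale_zero_right)
        then show ?case by simp
      next
        case (single p c)
        have "basis_vec p \<in> ?V" using single by (rule single_in_space_on)
        then have "h' (lpa_cls Q g) (pscale c (basis_vec p)) = h (lpa_cls Q g) (pscale c (basis_vec p))"
          using E h' hg g single by (simp add: End_alg_def del: pscale_single)
        then show ?case by simp
      qed (use E in \<open>auto simp: End_alg_def\<close>)
      then show "h' (lpa_cls Q g) = h (lpa_cls Q g)"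
        using E by (intro PiE_ext[of _ ?V "\<lambda>_. ?V"]) (auto simp: End_alg_def)
    qed (use h h' in auto)
  qed (use h hg in auto)
  then show "ract (basis_rep Q P act) \<in> alg_hom (lpa Q) (End_alg pscale (space_on P))"
    "\<And>g p. g \<in> lpa_gens Q \<Longrightarrow> p \<in> P \<Longrightarrow> ract (basis_rep Q P act) (lpa_cls Q g) (basis_vec p) = act g p"
    "\<And>f x. f \<in> free_alg (lpa_gens Q) \<Longrightarrow> x \<in> space_on P \<Longrightarrow>
      ract (basis_rep Q P act) (coset (lpa_ideal Q) f) x = rho act f x"
    using h hg by (auto simp: H_def)
qed

end

lemma subrep_basis_rep:
  fixes act :: "('v, 'e) lpa_gen \<Rightarrow> 'p \<Rightarrow> ('p \<Rightarrow>\<^sub>0 'k::field)"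
  assumes Q: "wf_digraph Q"
    and P: "\<And>g p. g \<in> lpa_gens Q \<Longrightarrow> p \<in> P \<Longrightarrow> act g p \<in> space_on P"
    and C: "\<And>g p. g \<in> lpa_gens Q \<Longrightarrow> p \<in> C \<Longrightarrow> act g p \<in> space_on C" "C \<subseteq> P"
    and rel: "\<And>r p. r \<in> lpa_rels Q \<Longrightarrow> p \<in> P \<Longrightarrow> rho act r (basis_vec p) = 0"
  shows "subrep (lpa Q) (basis_rep Q P act) (pscale.span (basis_vec ` C)) = basis_rep Q C act"
proof -
  let ?A = "free_alg (lpa_gens Q) :: (('v, 'e) lpa_gen, 'k) free_algebra set"
  interpret alg_ideal ?A "lpa_ideal Q" by (rule alg_ideal_lpa[OF Q])
  have relC: "\<And>r p. r \<in> lpa_rels Q \<Longrightarrow> p \<in> C \<Longrightarrow> rho act r (basis_vec p) = 0"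
    using rel C(2) by auto
  have rP: "ract (basis_rep Q P act) (coset (lpa_ideal Q) f) x = rho act f x"
    if "f \<in> ?A" "x \<in> space_on P" for f x
    by (rule ract_basis_rep(3)[OF Q _ _ that]) (fact P rel)+
  have rC: "ract (basis_rep Q C act) (coset (lpa_ideal Q) f) x = rho act f x"
    if "f \<in> ?A" "x \<in> space_on C" for f x
    by (rule ract_basis_rep(3)[OF Q _ _ that]) (fact C(1) relC)+
  have rC1: "ract (basis_rep Q C act) \<in> alg_hom (lpa Q) (End_alg pscale (space_on C))"
    by (rule ract_basis_rep(1)[OF Q]) (fact C(1) relC)+
  have sub: "x \<in> space_on C \<Longrightarrow> x \<in> space_on P" for x :: "'p \<Rightarrow>\<^sub>0 'k"
    using C(2) by (auto simp: space_on_def)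
  let ?r = "\<lambda>u\<in>acarrier (lpa Q). \<lambda>x\<in>space_on C. ract (basis_rep Q P act) u x"
  have "?r u = ract (basis_rep Q C act) u" for u
  proof (cases "u \<in> acarrier (lpa Q)")
    case True
    then obtain f where f: "f \<in> ?A" "u = coset (lpa_ideal Q) f"
      by (auto simp: lpa_def carrier_eq)
    have "ract (basis_rep Q C act) u \<in> acarrier (End_alg pscale (space_on C))"
      using rC1 True by (auto simp: alg_hom_def)
    then have "ract (basis_rep Q C act) u \<in> space_on C \<rightarrow>\<^sub>E space_on C" by (simp add: End_alg_def)
    then have arb: "ract (basis_rep Q C act) u x = undefined" if "x \<notin> space_on C" for x
      using that by (rule PiE_arb)
    have eq: "ract (basis_rep Q P act) u x = ract (basis_rep Q C act) u x" if "x \<in> space_on C" for x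
      unfolding f(2) using rP[OF f(1) sub[OF that]] rC[OF f(1) that] by (rule trans[OF _ sym])
    show ?thesis
    proof (rule ext)
      fix x show "?r u x = ract (basis_rep Q C act) u x"
        using True by (cases "x \<in> space_on C") (simp_all add: arb eq)
    qed
  next
    case False
    then have "ract (basis_rep Q C act) u = undefined"
      using rC1 by (intro PiE_arb) (auto simp: alg_hom_def)
    with False show ?thesis by simp
  qed
  then have "?r = ract (basis_rep Q C act)" by blast
  then show ?thesis by (simp add: subrep_def span_basis) (simp add: basis_rep_def)
qed

lemma lpa_relsI:
  fixes act :: "('v, 'e) lpa_gen \<Rightarrow> 'p \<Rightarrow> ('p \<Rightarrow>\<^sub>0 'k::field)"
  assumes r: "r \<in> lpa_rels Q"
    and "\<And>i j. i \<in> verts Q \<Longrightarrow> j \<in> verts Q \<Longrightarrow>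
      lin (act (Vertex i)) (act (Vertex j) p) = (if i = j then act (Vertex i) p else 0)"
    and "\<And>\<alpha>. \<alpha> \<in> arcs Q \<Longrightarrow> lin (act (Vertex (head Q \<alpha>))) (act (Arrow \<alpha>) p) = act (Arrow \<alpha>) p"
    and "\<And>\<alpha>. \<alpha> \<in> arcs Q \<Longrightarrow> lin (act (Arrow \<alpha>)) (act (Vertex (tail Q \<alpha>)) p) = act (Arrow \<alpha>) p"
    and "\<And>\<alpha>. \<alpha> \<in> arcs Q \<Longrightarrow> lin (act (Vertex (tail Q \<alpha>))) (act (Ghost \<alpha>) p) = act (Ghost \<alpha>) p"
    and "\<And>\<alpha>. \<alpha> \<in> arcs Q \<Longrightarrow> lin (act (Ghost \<alpha>)) (act (Vertex (head Q \<alpha>)) p) = act (Ghost \<alpha>) p"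
    and "\<And>\<alpha> \<beta>. \<alpha> \<in> arcs Q \<Longrightarrow> \<beta> \<in> arcs Q \<Longrightarrow>
      lin (act (Arrow \<alpha>)) (act (Ghost \<beta>) p) = (if \<alpha> = \<beta> then act (Vertex (head Q \<alpha>)) p else 0)"
    and "\<And>i. regular_vertex Q i \<Longrightarrow>
      (\<Sum>\<alpha>\<in>out_arcs Q i. lin (act (Ghost \<alpha>)) (act (Arrow \<alpha>) p)) = act (Vertex i) p"
  shows "rho act r (basis_vec p) = 0"
  using r unfolding lpa_rels_def
  by (elim UnE CollectE exE conjE) (simp_all add: rho_diff rho_mult rho_sum assms del: mult_single)

lemma inf_paths_stl: "p \<in> inf_paths Q \<Longrightarrow> stl p \<in> inf_paths Q"
  by (auto simp: inf_paths_def streams_stl) (metis snth.simps(2))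

lemma inf_paths_SCons:
  "\<alpha> \<in> arcs Q \<Longrightarrow> p \<in> inf_paths Q \<Longrightarrow> head Q \<alpha> = tail Q (shd p) \<Longrightarrow> \<alpha> ## p \<in> inf_paths Q"
  by (auto simp: inf_paths_def) (metis not0_implies_Suc snth.simps stream.sel)

lemma shd_inf_path: "p \<in> inf_paths Q \<Longrightarrow> shd p \<in> arcs Q"
  by (auto simp: inf_paths_def streams_shd)

lemma tail_stl: "p \<in> inf_paths Q \<Longrightarrow> tail Q (shd (stl p)) = head Q (shd p)"
  by (auto simp: inf_paths_def dest!: spec[of _ 0])

lemma F_act_space:
  assumes "g \<in> lpa_gens Q" "p \<in> inf_paths Q"
  shows "F_act Q g p \<in> space_on (inf_paths Q)"
  using assms pscale.subspace_0[OF subspace_space_on, of "inf_paths Q"]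
  by (cases g) (auto simp: lpa_gens_def inf_paths_SCons inf_paths_stl intro!: single_in_space_on)

lemma tail_class_subset: "tail_class Q p \<subseteq> inf_paths Q"
  by (auto simp: tail_class_def tail_equiv_def)

lemma F_act_class:
  assumes g: "g \<in> lpa_gens Q" and q: "q \<in> tail_class Q p"
  shows "F_act Q g q \<in> space_on (tail_class Q p)"
proof -
  from q obtain n m where nm: "sdrop n p = sdrop m q" "p \<in> inf_paths Q" "q \<in> inf_paths Q"
    by (auto simp: tail_class_def tail_equiv_def)
  have eq: "sdrop (Suc n) p = sdrop m (stl q)"
    using arg_cong[OF nm(1), of stl] by simp
  have "stl q \<in> tail_class Q p"
    using nm eq inf_paths_stl[OF nm(3)] unfolding tail_class_def tail_equiv_def by blast
  moreover have "\<alpha> ## q \<in> tail_class Q p" if "\<alpha> \<in> arcs Q" "head Q \<alpha> = tail Q (shd q)" for \<alpha>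
  proof -
    have "sdrop n p = sdrop (Suc m) (\<alpha> ## q)" using nm(1) by simp
    then show ?thesis
      using nm inf_paths_SCons[OF that(1) nm(3) that(2)] unfolding tail_class_def tail_equiv_def by blast
  qed
  ultimately show ?thesis
    using g q pscale.subspace_0[OF subspace_space_on, of "tail_class Q p"]
    by (cases g) (auto simp: lpa_gens_def intro!: single_in_space_on)
qed

lemma F_rel:
  assumes "wf_digraph Q" "r \<in> lpa_rels Q" "p \<in> inf_paths Q"
  shows "rho (F_act Q) r (basis_vec p) = 0"
  using assms(2)
proof (rule lpa_relsI)
  fix i assume i: "regular_vertex Q i"
  have "(\<Sum>\<alpha>\<in>out_arcs Q i. lin (F_act Q (Ghost \<alpha>)) (F_act Q (Arrow \<alpha>) p)) =
     (\<Sum>\<alpha>\<in>out_arcs Q i. if shd p = \<alpha> then basis_vec p else 0)"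
    using assms(3) by (intro sum.cong) (auto simp: tail_stl)
  then show "(\<Sum>\<alpha>\<in>out_arcs Q i. lin (F_act Q (Ghost \<alpha>)) (F_act Q (Arrow \<alpha>) p)) = F_act Q (Vertex i) p"
    using i shd_inf_path[OF assms(3)] by (auto simp: regular_vertex_def)
qed (auto simp: tail_stl[OF assms(3)])

lemma N_act_space:
  assumes Q: "wf_digraph Q" and g: "g \<in> lpa_gens Q" and "p \<in> sink_paths_to Q i"
  shows "N_act Q g p \<in> space_on (sink_paths_to Q i)"
proof -
  interpret wf_digraph Q by fact
  show ?thesis
    using assms pscale.subspace_0[OF subspace_space_on, of "sink_paths_to Q i"]
    by (cases "(Q, g, p)" rule: N_act.cases)
      (auto simp: lpa_gens_def sink_paths_to_def awalk_def intro!: single_in_space_on)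
qed

lemma N_act_space':
  assumes "wf_digraph Q" "g \<in> lpa_gens Q" "p \<in> sink_paths Q"
  shows "N_act Q g p \<in> space_on (sink_paths Q)"
  using assms N_act_space[of Q g p] unfolding sink_paths_def space_on_def by blast

lemma N_rel:
  assumes Q: "wf_digraph Q" and r: "r \<in> lpa_rels Q" and p: "p \<in> sink_paths Q"
  shows "rho (N_act Q) r (basis_vec p) = 0"
proof -
  interpret wf_digraph Q by fact
  obtain u xs where p': "p = (u, xs)" by (cases p)
  obtain j where j: "awalk u xs j" "sink Q j" using p by (auto simp: sink_paths_def sink_paths_to_def p')
  show ?thesis using r
  proof (rule lpa_relsI)
    fix i assume i: "regular_vertex Q i"
    show "(\<Sum>\<alpha>\<in>out_arcs Q i. lin (N_act Q (Ghost \<alpha>)) (N_act Q (Arrow \<alpha>) p)) = N_act Q (Vertex i) p"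
    proof (cases xs)
      case Nil
      with j i show ?thesis by (auto simp: p' awalk_def regular_vertex_def)
    next
      case (Cons x ys)
      have "(\<Sum>\<alpha>\<in>out_arcs Q i. lin (N_act Q (Ghost \<alpha>)) (N_act Q (Arrow \<alpha>) p)) =
         (\<Sum>\<alpha>\<in>out_arcs Q i. if x = \<alpha> then basis_vec p else 0)"
        using j Cons by (intro sum.cong) (auto simp: p' awalk_def)
      then show ?thesis using i j Cons by (auto simp: p' regular_vertex_def awalk_def)
    qed
  qed (use j in \<open>cases xs; auto simp: p' awalk_def\<close>)+
qed

lemma representation_basis_rep:
  fixes act :: "('v, 'e) lpa_gen \<Rightarrow> 'p \<Rightarrow> ('p \<Rightarrow>\<^sub>0 'k::field)"
  assumes Q: "wf_digraph Q"
    and P: "\<And>g p. g \<in> lpa_gens Q \<Longrightarrow> p \<in> P \<Longrightarrow> act g p \<in> space_on P"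
    and rel: "\<And>r p. r \<in> lpa_rels Q \<Longrightarrow> p \<in> P \<Longrightarrow> rho act r (basis_vec p) = 0"
  shows "representation (lpa Q) (basis_rep Q P act)"
  using ract_basis_rep(1)[OF Q P rel] subspace_space_on[of P] pscale.vector_space_axioms
  by (simp add: representation_def) (simp add: basis_rep_def)

theorem representation_F_rep:
  assumes "wf_digraph Q"
  shows "representation (lpa Q) (F_rep Q)"
    and "g \<in> lpa_gens Q \<Longrightarrow> p \<in> inf_paths Q \<Longrightarrow>
      ract (F_rep Q) (lpa_cls Q g) (basis_vec p) = F_act Q g p"
proof -
  have sp: "g \<in> lpa_gens Q \<Longrightarrow> p \<in> inf_paths Q \<Longrightarrow> F_act Q g p \<in> space_on (inf_paths Q)" for g p
    by (rule F_act_space)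
  show "representation (lpa Q) (F_rep Q)"
    unfolding F_rep_def by (rule representation_basis_rep[OF assms sp F_rel[OF assms]])
  show "ract (F_rep Q) (lpa_cls Q g) (basis_vec p) = F_act Q g p"
    if "g \<in> lpa_gens Q" "p \<in> inf_paths Q"
    unfolding F_rep_def by (rule ract_basis_rep(2)[OF assms sp F_rel[OF assms] that])
qed

theorem F_class_conv:
  assumes "wf_digraph Q"
  shows "F_class Q (tail_class Q p) = basis_rep Q (tail_class Q p) (F_act Q)"
  unfolding F_class_def F_rep_def
  by (rule subrep_basis_rep[OF assms F_act_space F_act_class tail_class_subset F_rel[OF assms]])

theorem representation_F_class:
  assumes "wf_digraph Q"
  shows "representation (lpa Q) (F_class Q (tail_class Q p))"
  unfolding F_class_conv[OF assms]
  by (intro representation_basis_rep F_act_class F_rel assms; (assumption | erule subsetD[OF tail_class_subset]))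

theorem representation_N_rep:
  assumes "wf_digraph Q"
  shows "representation (lpa Q) (N_rep Q)"
    and "g \<in> lpa_gens Q \<Longrightarrow> p \<in> sink_paths Q \<Longrightarrow>
      ract (N_rep Q) (lpa_cls Q g) (basis_vec p) = N_act Q g p"
proof -
  have sp: "g \<in> lpa_gens Q \<Longrightarrow> p \<in> sink_paths Q \<Longrightarrow> N_act Q g p \<in> space_on (sink_paths Q)" for g p
    by (rule N_act_space'[OF assms])
  show "representation (lpa Q) (N_rep Q)"
    unfolding N_rep_def by (rule representation_basis_rep[OF assms sp N_rel[OF assms]])
  show "ract (N_rep Q) (lpa_cls Q g) (basis_vec p) = N_act Q g p"
    if "g \<in> lpa_gens Q" "p \<in> sink_paths Q"
    unfolding N_rep_def by (rule ract_basis_rep(2)[OF assms sp N_rel[OF assms] that])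
qed

lemma sink_paths_to_subset: "sink_paths_to Q i \<subseteq> sink_paths Q"
  by (auto simp: sink_paths_def)

theorem N_sink_conv:
  assumes "wf_digraph Q"
  shows "N_sink Q i = basis_rep Q (sink_paths_to Q i) (N_act Q)"
  unfolding N_sink_def N_rep_def
  by (rule subrep_basis_rep[OF assms N_act_space'[OF assms] N_act_space[OF assms]
        sink_paths_to_subset N_rel[OF assms]])

theorem representation_N_sink:
  assumes "wf_digraph Q"
  shows "representation (lpa Q) (N_sink Q i)"
  unfolding N_sink_conv[OF assms]
  by (intro representation_basis_rep N_act_space N_rel assms; (assumption | erule subsetD[OF sink_paths_to_subset]))


subsection \<open>Existence of the twisting automorphism\<close>

text \<open>\<open>twist_free a\<close> is the lift of \<open>\<gamma>\<^sub>a\<close> to the free algebra; it rescales every word.\<close>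

fun gen_weight :: "('e \<Rightarrow> 'k::field) \<Rightarrow> ('v, 'e) lpa_gen \<Rightarrow> 'k" where
  "gen_weight a (Vertex i) = 1"
| "gen_weight a (Arrow \<alpha>) = a \<alpha>"
| "gen_weight a (Ghost \<alpha>) = inverse (a \<alpha>)"

fun word_weight :: "('e \<Rightarrow> 'k::field) \<Rightarrow> ('v, 'e) lpa_gen free_monoid \<Rightarrow> 'k" where
  "word_weight a (Word w) = prod_list (map (gen_weight a) w)"

lemma word_weight_add: "word_weight a (v + w) = word_weight a v * word_weight a w"
  by (cases v; cases w) simp

definition twist_free ::
    "('e \<Rightarrow> 'k::field) \<Rightarrow> (('v, 'e) lpa_gen, 'k) free_algebra \<Rightarrow> (('v, 'e) lpa_gen, 'k) free_algebra" where
  "twist_free a = lin (\<lambda>w. Poly_Mapping.single w (word_weight a w))"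

lemma twist_free_simps:
  shows "twist_free a (f + g) = twist_free a f + twist_free a g"
    and "twist_free a (pscale c f) = pscale c (twist_free a f)"
    and "twist_free a 0 = 0"
    and "twist_free a (gen x) = pscale (gen_weight a x) (gen x)"
  by (simp_all add: twist_free_def lin_add lin_scale)

lemma twist_free_diff: "twist_free a (f - g) = twist_free a f - twist_free a g"
  using twist_free_simps(1)[of a "f - g" g] by simp

lemma twist_free_sum: "twist_free a (sum F X) = (\<Sum>x\<in>X. twist_free a (F x))"
  by (induction X rule: infinite_finite_induct) (auto simp: twist_free_simps)

lemma twist_free_mult: "twist_free a (f * g) = twist_free a f * twist_free a g"
  using space_on_UNIV[of f]
proof (induction f rule: space_on_induct)
  case (single v c)
  show ?case using space_on_UNIV[of g]
  proof (induction g rule: space_on_induct)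
    case (single w d)
    show ?case by (simp add: mult_single twist_free_def word_weight_add mult_ac)
  qed (simp_all add: algebra_simps twist_free_simps)
qed (simp_all add: algebra_simps twist_free_simps)

lemma twist_free_alg: "f \<in> free_alg S \<Longrightarrow> twist_free a f \<in> free_alg S"
  unfolding twist_free_def free_alg_def
  by (erule lin_in[OF subspace_space_on]) (rule single_in_space_on)

lemma twist_free_rel:
  fixes a :: "'e \<Rightarrow> 'k::field" and Q :: "('v, 'e) pre_digraph"
  assumes a: "a \<in> weights Q" and r: "r \<in> lpa_rels Q"
  shows "\<exists>c. twist_free a r = pscale c r"
proof -
  have nz: "\<alpha> \<in> arcs Q \<Longrightarrow> a \<alpha> \<noteq> 0" for \<alpha> using a by (auto simp: weights_def)
  note s = twist_free_diff twist_free_mult twist_free_simps twist_free_sum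
    pscale_mult_left pscale_mult_right pscale.scale_right_diff_distrib
  have 0: "\<exists>c. twist_free a (gen (Arrow \<alpha>) * gen (Ghost \<beta>) - (if \<alpha> = \<beta> then gen (Vertex (head Q \<alpha>)) else 0))
      = pscale c (gen (Arrow \<alpha>) * gen (Ghost \<beta>) - (if \<alpha> = \<beta> then gen (Vertex (head Q \<alpha>)) else 0))"
    if "\<alpha> \<in> arcs Q" "\<beta> \<in> arcs Q" for \<alpha> \<beta>
    using nz that
    by (intro exI[of _ "a \<alpha> * inverse (a \<beta>)"]) (simp add: s mult.commute del: mult_single pscale_single)
  have 1: "\<exists>c. twist_free a ((\<Sum>\<alpha>\<in>out_arcs Q i. gen (Ghost \<alpha>) * gen (Arrow \<alpha>)) - gen (Vertex i))
      = pscale c ((\<Sum>\<alpha>\<in>out_arcs Q i. gen (Ghost \<alpha>) * gen (Arrow \<alpha>)) - gen (Vertex i))" for i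
    using nz by (intro exI[of _ 1]) (simp add: s del: mult_single pscale_single)
  have 2: "\<exists>c. twist_free a (gen (Vertex i) * gen x - gen x) = pscale c (gen (Vertex i) * gen x - gen x)"
    "\<exists>c. twist_free a (gen x * gen (Vertex i) - gen x) = pscale c (gen x * gen (Vertex i) - gen x)" for i x
    by (rule exI[of _ "gen_weight a x"], simp add: s del: mult_single pscale_single)+
  have 3: "\<exists>c. twist_free a (gen (Vertex i) * gen (Vertex j) - (if i = j then gen (Vertex i) else 0))
      = pscale c (gen (Vertex i) * gen (Vertex j) - (if i = j then gen (Vertex i) else 0))" for i j
    by (intro exI[of _ 1]) (simp add: s del: mult_single pscale_single)
  show ?thesis
    using r unfolding lpa_rels_def
    apply (elim UnE CollectE exE conjE; hypsubst)
          apply (rule 3)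
         apply (rule 2)
        apply (rule 2)
       apply (rule 2)
      apply (rule 2)
     apply (rule 0; assumption)
    apply (rule 1)
    done
qed

theorem twist_aut:
  fixes a :: "'e \<Rightarrow> 'k::field" and Q :: "('v, 'e) pre_digraph"
  assumes Q: "wf_digraph Q" and a: "a \<in> weights Q"
  shows "twist_aut Q a \<in> alg_hom (lpa Q) (lpa Q)"
    and "\<And>i. i \<in> verts Q \<Longrightarrow> twist_aut Q a (lpa_cls Q (Vertex i)) = lpa_cls Q (Vertex i)"
    and "\<And>\<alpha>. \<alpha> \<in> arcs Q \<Longrightarrow>
      twist_aut Q a (lpa_cls Q (Arrow \<alpha>)) = ascale (lpa Q) (a \<alpha>) (lpa_cls Q (Arrow \<alpha>))"
    and "\<And>\<alpha>. \<alpha> \<in> arcs Q \<Longrightarrow>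
      twist_aut Q a (lpa_cls Q (Ghost \<alpha>)) = ascale (lpa Q) (inverse (a \<alpha>)) (lpa_cls Q (Ghost \<alpha>))"
    and "\<And>f. f \<in> free_alg (lpa_gens Q) \<Longrightarrow>
      twist_aut Q a (coset (lpa_ideal Q) f) = coset (lpa_ideal Q) (twist_free a f)"
proof -
  let ?A = "free_alg (lpa_gens Q) :: (('v, 'e) lpa_gen, 'k) free_algebra set"
  let ?I = "lpa_ideal Q :: (('v, 'e) lpa_gen, 'k) free_algebra set"
  interpret alg_ideal ?A ?I by (rule alg_ideal_lpa[OF Q])
  have ideal: "twist_free a f \<in> ?I" if "f \<in> ?I" for f
    using that unfolding lpa_ideal_def
  proof (induction f)
    case (base r)
    then show ?case using twist_free_rel[OF a base] ideal_gen.scale[OF ideal_gen.base[OF base]] by auto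
  qed (auto simp: twist_free_simps twist_free_mult intro: ideal_gen.intros twist_free_alg)
  have "\<exists>h\<in>alg_hom (quotient_alg ?A ?I) (lpa Q).
      \<forall>f\<in>?A. h (coset ?I f) = coset ?I (twist_free a f)"
    unfolding lpa_def
    by (rule lift)
      (auto simp: carrier_eq zero_eq add_eq scale_eq mult_eq coset_eq twist_free_alg
        twist_free_simps twist_free_mult twist_free_diff[symmetric] ideal)
  then obtain h where h: "h \<in> alg_hom (lpa Q) (lpa Q)"
      "\<And>f. f \<in> ?A \<Longrightarrow> h (coset ?I f) = coset ?I (twist_free a f)"
    by (auto simp: lpa_def)
  have hg: "h (lpa_cls Q g) = ascale (lpa Q) (gen_weight a g) (lpa_cls Q g)" if "g \<in> lpa_gens Q" for g
    using h(2)[OF gen_in_free_alg[OF that]]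
    by (simp add: lpa_cls_def lpa_def scale_eq twist_free_simps del: pscale_single)
  have one: "ascale (lpa Q) 1 (lpa_cls Q g :: (('v, 'e) lpa_gen, 'k) free_algebra set) = lpa_cls Q g" for g
    by (simp add: lpa_cls_def lpa_def scale_eq)
  have "twist_aut Q a = h"
    unfolding twist_aut_def
  proof (rule the_equality)
    fix h' assume h': "h' \<in> alg_hom (lpa Q) (lpa Q) \<and>
     (\<forall>i\<in>verts Q. h' (lpa_cls Q (Vertex i)) = lpa_cls Q (Vertex i)) \<and>
     (\<forall>\<alpha>\<in>arcs Q. h' (lpa_cls Q (Arrow \<alpha>)) = ascale (lpa Q) (a \<alpha>) (lpa_cls Q (Arrow \<alpha>)) \<and>
       h' (lpa_cls Q (Ghost \<alpha>)) = ascale (lpa Q) (inverse (a \<alpha>)) (lpa_cls Q (Ghost \<alpha>)))"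
    show "h' = h"
      by (rule lpa_hom_unique[OF Q, of _ "lpa Q"]) (use h' h hg one in \<open>auto simp: lpa_gens_def\<close>)
  qed (use h hg one in \<open>auto simp: lpa_gens_def\<close>)
  then show "twist_aut Q a \<in> alg_hom (lpa Q) (lpa Q)"
    "\<And>i. i \<in> verts Q \<Longrightarrow> twist_aut Q a (lpa_cls Q (Vertex i)) = lpa_cls Q (Vertex i)"
    "\<And>\<alpha>. \<alpha> \<in> arcs Q \<Longrightarrow>
      twist_aut Q a (lpa_cls Q (Arrow \<alpha>)) = ascale (lpa Q) (a \<alpha>) (lpa_cls Q (Arrow \<alpha>))"
    "\<And>\<alpha>. \<alpha> \<in> arcs Q \<Longrightarrow>
      twist_aut Q a (lpa_cls Q (Ghost \<alpha>)) = ascale (lpa Q) (inverse (a \<alpha>)) (lpa_cls Q (Ghost \<alpha>))"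
    "\<And>f. f \<in> free_alg (lpa_gens Q) \<Longrightarrow>
      twist_aut Q a (coset (lpa_ideal Q) f) = coset (lpa_ideal Q) (twist_free a f)"
    using h hg one by (auto simp: lpa_gens_def)
qed

lemma twist_free_inverse:
  assumes a: "a \<in> weights Q" and f: "f \<in> free_alg (lpa_gens Q)"
  shows "twist_free (\<lambda>\<alpha>. inverse (a \<alpha>)) (twist_free a f) = f"
    and "twist_free a (twist_free (\<lambda>\<alpha>. inverse (a \<alpha>)) f) = f"
proof -
  have w: "word_weight a w * word_weight (\<lambda>\<alpha>. inverse (a \<alpha>)) w = 1"
    if w: "w \<in> Word ` (lists (lpa_gens Q) - {[]})" for w
  proof -
    obtain l where l: "w = Word l" "l \<in> lists (lpa_gens Q)" using w by auto
    have "g \<in> lpa_gens Q \<Longrightarrow> gen_weight a g * gen_weight (\<lambda>\<alpha>. inverse (a \<alpha>)) g = 1" for g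
      using a by (cases g) (auto simp: weights_def lpa_gens_def Pi_iff)
    with l(2) have "prod_list (map (gen_weight a) l) * prod_list (map (gen_weight (\<lambda>\<alpha>. inverse (a \<alpha>))) l) = 1"
      by (induction l) (auto simp: mult_ac)
    with l show ?thesis by simp
  qed
  show "twist_free (\<lambda>\<alpha>. inverse (a \<alpha>)) (twist_free a f) = f"
    "twist_free a (twist_free (\<lambda>\<alpha>. inverse (a \<alpha>)) f) = f"
    using f unfolding free_alg_def
    by (induction f rule: space_on_induct)
      (simp_all add: twist_free_simps, simp_all add: twist_free_def mult.assoc w w[unfolded mult.commute[of "word_weight a _"]])
qed

theorem twist_aut_bij:
  fixes a :: "'e \<Rightarrow> 'k::field" and Q :: "('v, 'e) pre_digraph"
  assumes Q: "wf_digraph Q" and a: "a \<in> weights Q"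
  shows "bij_betw (twist_aut Q a) (acarrier (lpa Q)) (acarrier (lpa Q))"
proof -
  interpret alg_ideal "free_alg (lpa_gens Q)" "lpa_ideal Q :: (('v, 'e) lpa_gen, 'k) free_algebra set"
    by (rule alg_ideal_lpa[OF Q])
  have b: "(\<lambda>\<alpha>. inverse (a \<alpha>)) \<in> weights Q" using a by (auto simp: weights_def)
  show ?thesis
    by (rule bij_betw_byWitness[where f' = "twist_aut Q (\<lambda>\<alpha>. inverse (a \<alpha>))"])
      (auto simp: lpa_def carrier_eq twist_aut(5)[OF Q a] twist_aut(5)[OF Q b] twist_free_alg
        twist_free_inverse[OF a])
qed

theorem representation_twist:
  fixes a :: "'e \<Rightarrow> 'k::field" and Q :: "('v, 'e) pre_digraph"
  assumes Q: "wf_digraph Q" and a: "a \<in> weights Q" and M: "representation (lpa Q) M"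
  shows "representation (lpa Q) (twist Q a M)"
proof -
  interpret alg_ideal "free_alg (lpa_gens Q)" "lpa_ideal Q :: (('v, 'e) lpa_gen, 'k) free_algebra set"
    by (rule alg_ideal_lpa[OF Q])
  have closed: "x \<in> acarrier (lpa Q) \<Longrightarrow> y \<in> acarrier (lpa Q) \<Longrightarrow> aadd (lpa Q) x y \<in> acarrier (lpa Q)"
    "x \<in> acarrier (lpa Q) \<Longrightarrow> y \<in> acarrier (lpa Q) \<Longrightarrow> amult (lpa Q) x y \<in> acarrier (lpa Q)"
    "x \<in> acarrier (lpa Q) \<Longrightarrow> ascale (lpa Q) c x \<in> acarrier (lpa Q)"
    "(azero (lpa Q) :: (('v, 'e) lpa_gen, 'k) free_algebra set) \<in> acarrier (lpa Q)" for x y :: "(('v, 'e) lpa_gen, 'k) free_algebra set" and c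
    by (auto simp: lpa_def carrier_eq add_eq mult_eq scale_eq zero_eq intro!: imageI AA
        pscale.subspace_add[OF A] pscale.subspace_scale[OF A] pscale.subspace_0[OF A])
  have t: "x \<in> acarrier (lpa Q) \<Longrightarrow> twist_aut Q a (x :: (('v, 'e) lpa_gen, 'k) free_algebra set) \<in> acarrier (lpa Q)" for x
    using twist_aut(1)[OF Q a] by (auto simp: alg_hom_def)
  show ?thesis
    using M twist_aut(1)[OF Q a] closed t
    by (auto simp: representation_def twist_def alg_hom_def intro!: restrictI)
qed

end

theory Submission
  imports Defs
begin

text \<open>
  A map rescaling each basis vector \<open>s\<close> by a nonzero scalar \<open>l s\<close> is an isomorphism from the
  \<open>a\<close>-twist to the \<open>b\<close>-twist as soon as \<open>l s = c \<alpha>\<^sub>1 * l (\<tau>\<^bsub>>1\<^esub> s)\<close>, where \<open>c = a / b\<close>.  On paths to a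
  sink \<open>l\<close> is the product of \<open>c\<close> along the path.  On the tail class of \<open>p\<close> one puts
  \<open>l s = c(\<alpha>\<^sub>1) \<cdots> c(\<alpha>\<^sub>m) / (c(\<beta>\<^sub>1) \<cdots> c(\<beta>\<^sub>n))\<close> whenever \<open>\<tau>\<^bsub>>m\<^esub> s = \<tau>\<^bsub>>n\<^esub> p\<close>; this is well defined if \<open>c\<close> has
  product 1 over every period of \<open>p\<close>, which is vacuous for irrational \<open>p\<close>, and for \<open>p = q\<^sup>\<infinity>\<close> with \<open>q\<close>
  simple it says that \<open>c\<close> is \<open>q\<close>-stable, because all periods are multiples of the length of \<open>q\<close>.
  Conversely, the image \<open>w\<close> of \<open>q\<^sup>\<infinity>\<close> under an isomorphism satisfies \<open>q.w = c\<^sub>q w\<close>.  Comparing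
  coefficients, the support of \<open>w\<close> is closed under \<open>s \<mapsto> s q\<close>; being finite it is contained
  in \<open>{q\<^sup>\<infinity>}\<close>, and the coefficient there gives \<open>c\<^sub>q = 1\<close>.
\<close>

section \<open>Intertwining twisted basis representations\<close>

text \<open>Replaces the definite descriptions behind \<open>twist_aut\<close> and
  \<open>basis_rep\<close> by explicit maps on the free algebra, so that intertwining can be checked
  on words.\<close>

lemma ract_twist_basis_rep:
  fixes Q :: "('v, 'e) pre_digraph" and a :: "'e \<Rightarrow> 'k::field"
    and act :: "('v, 'e) lpa_gen \<Rightarrow> 'p \<Rightarrow> ('p \<Rightarrow>\<^sub>0 'k)"
  assumes Q: "wf_digraph Q" and a: "a \<in> weights Q"
    and P: "\<And>g p. g \<in> lpa_gens Q \<Longrightarrow> p \<in> P \<Longrightarrow> act g p \<in> space_on P"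
    and rel: "\<And>r p. r \<in> lpa_rels Q \<Longrightarrow> p \<in> P \<Longrightarrow> rho act r (basis_vec p) = 0"
    and f: "f \<in> free_alg (lpa_gens Q)" and x: "x \<in> space_on P"
  shows "ract (twist Q a (basis_rep Q P act)) (coset (lpa_ideal Q) f) x = rho act (twist_free a f) x"
proof -
  interpret alg_ideal "free_alg (lpa_gens Q)" "lpa_ideal Q :: (('v, 'e) lpa_gen, 'k) free_algebra set"
    by (rule alg_ideal_lpa[OF Q])
  have "coset (lpa_ideal Q) f \<in> acarrier (lpa Q)"
    using f by (simp add: lpa_def carrier_eq)
  then show ?thesis
    using ract_basis_rep(3)[OF Q P rel twist_free_alg[OF f] x, of a]
    by (simp add: twist_def twist_aut(5)[OF Q a f])
qed

lemma twist_free_single: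
  "twist_free a (Poly_Mapping.single w d) = pscale d (Poly_Mapping.single w (word_weight a w))"
  by (simp add: twist_free_def)

text \<open>Intertwining on generators and basis vectors propagates to words letter by letter and
  then to all of \<open>free_alg S\<close> by linearity.\<close>

lemma lin_rho_twist_free:
  fixes act :: "('v, 'e) lpa_gen \<Rightarrow> 'p \<Rightarrow> ('p \<Rightarrow>\<^sub>0 'k::field)"
  assumes P: "\<And>g p. g \<in> S \<Longrightarrow> p \<in> P \<Longrightarrow> act g p \<in> space_on P"
    and comm: "\<And>g p. g \<in> S \<Longrightarrow> p \<in> P \<Longrightarrow>
      pscale (gen_weight a g) (lin \<psi> (act g p)) = pscale (gen_weight b g) (lin (act g) (\<psi> p))"
    and f: "f \<in> free_alg S" and x: "x \<in> space_on P"
  shows "lin \<psi> (rho act (twist_free a f) x) = rho act (twist_free b f) (lin \<psi> x)"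
proof -
  have gen: "pscale (gen_weight a g) (lin \<psi> (lin (act g) y))
      = pscale (gen_weight b g) (lin (act g) (lin \<psi> y))" if "g \<in> S" "y \<in> space_on P" for g y
    using that(2)
  proof (induction y rule: space_on_induct)
    case (single p d)
    have "pscale (gen_weight a g) (pscale d (lin \<psi> (act g p)))
        = pscale (gen_weight b g) (pscale d (lin (act g) (\<psi> p)))"
      using comm[OF that(1) single] by (metis pscale.scale_left_commute)
    then show ?case by (simp add: lin_scale)
  qed (simp_all add: lin_add pscale.scale_right_distrib)
  \<comment> \<open>Membership in \<open>space_on P\<close> is part of the induction because
    \<open>gen\<close> applies only to such vectors.\<close>
  have word: "foldr (\<lambda>g. lin (act g)) l x \<in> space_on P \<and>
      pscale (word_weight a (Word l)) (lin \<psi> (wop act (Word l) x))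
      = pscale (word_weight b (Word l)) (wop act (Word l) (lin \<psi> x))" if "l \<in> lists S" for l
    using that
  proof (induction l)
    case Nil
    show ?case using x by simp
  next
    case (Cons g l)
    let ?y = "foldr (\<lambda>g. lin (act g)) l x"
    let ?z = "foldr (\<lambda>g. lin (act g)) l (lin \<psi> x)"
    let ?A = "word_weight a (Word l)" and ?B = "word_weight b (Word l)"
    have y: "?y \<in> space_on P" and IH: "pscale ?A (lin \<psi> ?y) = pscale ?B ?z"
      using Cons by auto
    have "pscale (gen_weight a g * ?A) (lin \<psi> (lin (act g) ?y))
        = pscale ?A (pscale (gen_weight a g) (lin \<psi> (lin (act g) ?y)))"
      by (simp add: mult.commute)
    also have "\<dots> = pscale ?A (pscale (gen_weight b g) (lin (act g) (lin \<psi> ?y)))"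
      by (simp only: gen[OF Cons.hyps(1) y])
    also have "\<dots> = pscale (gen_weight b g) (lin (act g) (pscale ?A (lin \<psi> ?y)))"
      by (simp add: lin_scale mult.commute)
    also have "\<dots> = pscale (gen_weight b g) (lin (act g) (pscale ?B ?z))"
      by (simp only: IH)
    also have "\<dots> = pscale (gen_weight b g * ?B) (lin (act g) ?z)"
      by (simp add: lin_scale)
    finally have "pscale (gen_weight a g * ?A) (lin \<psi> (lin (act g) ?y))
        = pscale (gen_weight b g * ?B) (lin (act g) ?z)" .
    moreover have "lin (act g) ?y \<in> space_on P"
      using Cons.hyps(1) y by (intro lin_in[OF subspace_space_on y]) (auto intro: P)
    ultimately show ?case by simp
  qed
  show ?thesis using f unfolding free_alg_def
  proof (induction f rule: space_on_induct)
    case (single w d)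
    then obtain l where l: "w = Word l" "l \<in> lists S" by auto
    show ?case using word[OF l(2)]
      by (simp add: l(1) twist_free_single rho_single rho_scale lin_scale del: pscale_single pscale.scale_scale)
  qed (simp_all add: twist_free_simps rho_add lin_add)
qed

lemma lookup_lin_diag:
  "Poly_Mapping.lookup (lin (\<lambda>p. Poly_Mapping.single p (l p)) x) s = l s * Poly_Mapping.lookup x s"
  using space_on_UNIV[of x]
  by (induction x rule: space_on_induct)
    (auto simp: lin_add lookup_add lookup_single when_def algebra_simps)

lemma rep_iso_twist_diag:
  fixes Q :: "('v, 'e) pre_digraph" and a b :: "'e \<Rightarrow> 'k::field"
    and act :: "('v, 'e) lpa_gen \<Rightarrow> 'p \<Rightarrow> ('p \<Rightarrow>\<^sub>0 'k)"
  assumes Q: "wf_digraph Q" and a: "a \<in> weights Q" and b: "b \<in> weights Q"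
    and P: "\<And>g p. g \<in> lpa_gens Q \<Longrightarrow> p \<in> P \<Longrightarrow> act g p \<in> space_on P"
    and rel: "\<And>r p. r \<in> lpa_rels Q \<Longrightarrow> p \<in> P \<Longrightarrow> rho act r (basis_vec p) = 0"
    and nz: "\<And>p. p \<in> P \<Longrightarrow> l p \<noteq> 0"
    and comm: "\<And>g p. g \<in> lpa_gens Q \<Longrightarrow> p \<in> P \<Longrightarrow>
      pscale (gen_weight a g) (lin (\<lambda>p. Poly_Mapping.single p (l p)) (act g p))
      = pscale (gen_weight b g * l p) (act g p)"
  shows "rep_iso (lpa Q) (twist Q a (basis_rep Q P act)) (twist Q b (basis_rep Q P act))"
proof -
  interpret alg_ideal "free_alg (lpa_gens Q)" "lpa_ideal Q :: (('v, 'e) lpa_gen, 'k) free_algebra set"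
    by (rule alg_ideal_lpa[OF Q])
  let ?D = "\<lambda>l. lin (\<lambda>p. Poly_Mapping.single p (l p)) :: ('p \<Rightarrow>\<^sub>0 'k) \<Rightarrow> ('p \<Rightarrow>\<^sub>0 'k)"
  have D: "?D m x \<in> space_on P" if "x \<in> space_on P" for m x
    by (rule lin_in[OF subspace_space_on that]) (rule single_in_space_on)
  have inv: "?D (\<lambda>p. inverse (l p)) (?D l x) = x" "?D l (?D (\<lambda>p. inverse (l p)) x) = x"
    if "x \<in> space_on P" for x
  proof -
    \<comment> \<open>\<open>l\<close> may vanish outside \<open>P\<close>, but the coefficients of
      \<open>x\<close> are zero there.\<close>
    have z: "Poly_Mapping.lookup x s = 0" if "s \<notin> P" for s
      using \<open>x \<in> space_on P\<close> that by (auto simp: space_on_def in_keys_iff)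
    have "l s * (inverse (l s) * Poly_Mapping.lookup x s) = Poly_Mapping.lookup x s" for s
      using nz[of s] z[of s]
      by (cases "s \<in> P") (simp_all add: mult.assoc[symmetric])
    then show "?D (\<lambda>p. inverse (l p)) (?D l x) = x" "?D l (?D (\<lambda>p. inverse (l p)) x) = x"
      by (auto intro!: poly_mapping_eqI simp: lookup_lin_diag mult.left_commute)
  qed
  have ract: "?D l (ract (twist Q a (basis_rep Q P act)) (coset (lpa_ideal Q) f) x)
      = ract (twist Q b (basis_rep Q P act)) (coset (lpa_ideal Q) f) (?D l x)"
    if f: "f \<in> free_alg (lpa_gens Q)" and x: "x \<in> space_on P" for f x
    using ract_twist_basis_rep[where act = act, OF Q a P rel f x]
      ract_twist_basis_rep[where act = act, OF Q b P rel f D[OF x]]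
      lin_rho_twist_free[where act = act and a = a and b = b and P = P
        and \<psi> = "\<lambda>p. Poly_Mapping.single p (l p)", OF P _ f x]
    by (simp add: comm)
  have sp: "rspace (twist Q c (basis_rep Q P act)) = space_on P"
    "rscale (twist Q c (basis_rep Q P act)) = pscale" for c
    by (simp_all add: twist_def basis_rep_def)
  have "bij_betw (?D l) (space_on P) (space_on P)"
    by (rule bij_betw_byWitness[where f' = "?D (\<lambda>p. inverse (l p))"]) (auto simp: inv D)
  moreover have "?D l (ract (twist Q a (basis_rep Q P act)) u x)
        = ract (twist Q b (basis_rep Q P act)) u (?D l x)"
    if u: "u \<in> acarrier (lpa Q)" and x: "x \<in> space_on P"
    for u :: "(('v, 'e) lpa_gen, 'k) free_algebra set" and x
  proof -
    obtain f where "f \<in> free_alg (lpa_gens Q)" "u = coset (lpa_ideal Q) f"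
      using u by (auto simp: lpa_def carrier_eq)
    then show ?thesis using ract x by blast
  qed
  ultimately show ?thesis
    unfolding rep_iso_def sp by (intro exI[of _ "?D l"] conjI ballI allI lin_add lin_scale)
qed

section \<open>Periods of left-infinite paths\<close>

definition initial_weight :: "('e \<Rightarrow> 'k::field) \<Rightarrow> nat \<Rightarrow> 'e stream \<Rightarrow> 'k" where
  "initial_weight c n s = prod_list (map c (stake n s))"

lemma initial_weight_add:
  "initial_weight c (m + n) s = initial_weight c m s * initial_weight c n (sdrop m s)"
  by (metis initial_weight_def map_append prod_list.append stake_add)

lemma initial_weight_nonzero:
  assumes "s \<in> streams A" "\<And>x. x \<in> A \<Longrightarrow> c x \<noteq> 0"
  shows "initial_weight c n s \<noteq> 0"
  using assms(1) unfolding initial_weight_def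
  by (induction n arbitrary: s) (auto simp: assms(2) streams_shd streams_stl)

text \<open>If \<open>c\<close> is nonzero along \<open>p\<close>, this amounts to \<open>c\<close>
  having product 1 over every stretch between two equal tails.\<close>

definition stable_along :: "('e \<Rightarrow> 'k::field) \<Rightarrow> 'e stream \<Rightarrow> bool" where
  "stable_along c p \<longleftrightarrow>
     (\<forall>n m. sdrop n p = sdrop m p \<longrightarrow> initial_weight c n p = initial_weight c m p)"

text \<open>The cross-multiplied form of well-definedness of
  \<open>initial_weight c m s / initial_weight c n p\<close>. If \<open>m' = m + k\<close>,
  stability lets \<open>n + k\<close> replace \<open>n'\<close>, and the same \<open>k\<close> extra
  arrows then contribute to both sides.\<close>

lemma initial_weight_ratio:
  assumes st: "stable_along c p"
    and eq: "sdrop m s = sdrop n p" "sdrop m' s = sdrop n' p"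
  shows "initial_weight c m s * initial_weight c n' p = initial_weight c m' s * initial_weight c n p"
proof -
  have *: "initial_weight c m s * initial_weight c n' p = initial_weight c m' s * initial_weight c n p"
    if eq: "sdrop m s = sdrop n p" "sdrop m' s = sdrop n' p" and "m \<le> m'" for m n m' n'
  proof -
    obtain k where k: "m' = m + k" using \<open>m \<le> m'\<close> le_Suc_ex by blast
    have "sdrop (n + k) p = sdrop n' p"
      using eq by (metis k sdrop_add)
    then have "initial_weight c n' p = initial_weight c n p * initial_weight c k (sdrop n p)"
      using st by (metis stable_along_def initial_weight_add)
    then show ?thesis by (simp add: k initial_weight_add eq(1))
  qed
  show ?thesis
    using *[OF eq] *[OF eq(2,1)] by (cases "m \<le> m'") auto
qed

section \<open>Periodic streams\<close>

lemma shift_fixpoint_eq_cycle: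
  assumes "xs \<noteq> []" "s = xs @- s"
  shows "s = cycle xs"
proof -
  \<comment> \<open>Unfolding the equation once lowers the index by \<open>length xs\<close>, so
    both streams obey the same recursion.\<close>
  have "s !! i = cycle xs !! i" for i
  proof (induction i rule: less_induct)
    case (less i)
    have "s !! i = (if i < length xs then xs ! i else s !! (i - length xs))"
      using assms(2) by (metis shift_snth_ge shift_snth_less not_less)
    also have "\<dots> = (if i < length xs then xs ! i else cycle xs !! (i - length xs))"
    proof (cases "i < length xs")
      case False
      moreover have "0 < length xs" using assms(1) by simp
      ultimately have "i - length xs < i" by arith
      then show ?thesis using less.IH False by simp
    qed simp
    also have "\<dots> = cycle xs !! i"
      using cycle_decomp[OF assms(1)] by (metis shift_snth_ge shift_snth_less not_less)
    finally show ?case .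
  qed
  then have "snth s = snth (cycle xs)" by blast
  then show ?thesis by (metis stream_smap_nats)
qed

lemma sdrop_period_eq_cycle:
  assumes "0 < d" "sdrop d s = s"
  shows "s = cycle (stake d s)"
  using assms by (intro shift_fixpoint_eq_cycle) (auto, metis stake_sdrop)

lemma sdrop_mult_period: "sdrop d s = s \<Longrightarrow> sdrop (d * k) s = s"
  by (induction k) (simp_all, metis sdrop_add)

lemma stake_mult_period:
  "sdrop d s = s \<Longrightarrow> stake (d * k) s = concat (replicate k (stake d s))"
proof (induction k)
  case (Suc k)
  have "stake (d * Suc k) s = stake d s @ stake (d * k) (sdrop d s)"
    by simp
  with Suc show ?case by simp
qed simp

text \<open>Bezout over the naturals: \<open>s\<close> is fixed by dropping \<open>d * x\<close> and
  by dropping \<open>e * y\<close> entries, hence by dropping their difference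
  \<open>gcd d e\<close>.\<close>

lemma sdrop_gcd_period:
  assumes "0 < d" "sdrop d s = s" "sdrop e s = s"
  shows "sdrop (gcd d e) s = s"
proof -
  obtain x y where "d * x = e * y + gcd d e"
    using bezout_nat[of d e] assms(1) by auto
  then show ?thesis
    using sdrop_mult_period[OF assms(2), of x] sdrop_mult_period[OF assms(3), of y]
    by (metis sdrop_add)
qed

section \<open>Periods of paths in a quiver and oriented cycles\<close>

lemma sdrop_inf_paths: "p \<in> inf_paths Q \<Longrightarrow> sdrop n p \<in> inf_paths Q"
  by (induction n arbitrary: p) (auto intro: inf_paths_stl)

lemma awalk_stake:
  assumes "wf_digraph Q" "p \<in> inf_paths Q"
  shows "pre_digraph.awalk Q (tail Q (shd p)) (stake n p) (tail Q (shd (sdrop n p)))"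
  using assms(2)
proof (induction n arbitrary: p)
  interpret wf_digraph Q by fact
  case 0
  then show ?case using shd_inf_path[OF 0] by (simp add: awalk_Nil_iff)
next
  interpret wf_digraph Q by fact
  case (Suc n)
  then show ?case
    using Suc.IH[OF inf_paths_stl[OF Suc.prems]] shd_inf_path[OF Suc.prems]
    by (simp add: awalk_Cons_iff tail_stl)
qed

lemma oriented_cycle_period:
  assumes "wf_digraph Q" "p \<in> inf_paths Q" "0 < d" "sdrop d p = p"
  shows "oriented_cycle Q (stake d p)"
  using awalk_stake[OF assms(1,2), of d] assms(3,4) unfolding oriented_cycle_def
  by auto

lemma cycle_inf_paths:
  assumes Q: "wf_digraph Q" and q: "oriented_cycle Q q"
  shows "cycle q \<in> inf_paths Q"
proof -
  interpret wf_digraph Q by fact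
  obtain i where i: "awalk i q i" and ne: "q \<noteq> []" using q by (auto simp: oriented_cycle_def)
  \<comment> \<open>The index \<open>n = length q - 1\<close> is the seam between \<open>q\<close>
    and \<open>s\<close>; there the hypothesis that \<open>s\<close> starts at the end vertex
    \<open>v\<close> is used.\<close>
  have step: "(q @- s) !! n \<in> arcs Q \<and> head Q ((q @- s) !! n) = tail Q ((q @- s) !! Suc n)"
    if "awalk u q v" "tail Q (shd s) = v" "n < length q" for u q v n s
    using that
  proof (induction q arbitrary: u n)
    case (Cons x q)
    then show ?case
      by (cases n; cases q) (auto simp: awalk_Cons_iff)
  qed simp
  have start: "tail Q (shd (Stream.cycle q)) = i"
    using i ne by (cases q) (auto simp: awalk_Cons_iff)
  have "Stream.cycle q !! n \<in> arcs Q \<and> head Q (Stream.cycle q !! n) = tail Q (Stream.cycle q !! Suc n)" for n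
  proof (induction n rule: less_induct)
    case (less n)
    show ?case
    proof (cases "n < length q")
      case True
      then show ?thesis using step[OF i start True] cycle_decomp[OF ne] by simp
    next
      case False
      \<comment> \<open>Beyond the first copy of \<open>q\<close>, shifting by
        \<open>length q\<close> reduces to a smaller index.\<close>
      have "Stream.cycle q !! m = Stream.cycle q !! (m - length q)" if "length q \<le> m" for m
        using cycle_decomp[OF ne] that by (metis shift_snth_ge)
      then have "Stream.cycle q !! n = Stream.cycle q !! (n - length q)"
        "Stream.cycle q !! Suc n = Stream.cycle q !! Suc (n - length q)"
        using False by (auto simp: Suc_diff_le simp del: snth.simps)
      moreover have "0 < length q" using ne by simp
      then have "n - length q < n" using False by arith
      ultimately show ?thesis using less.IH[of "n - length q"] by metis
    qed
  qed
  then show ?thesis by (auto simp: inf_paths_def streams_iff_snth)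
qed

text \<open>Two equal tails at different positions would make the tail periodic, hence cyclic, and
  \<open>p\<close> rational; so the condition only concerns \<open>n = m\<close>.\<close>

lemma irrational_stable_along:
  assumes Q: "wf_digraph Q" and p: "irrational_path Q p"
  shows "stable_along c p"
proof -
  have pQ: "p \<in> inf_paths Q" using p by (simp add: irrational_path_def)
  have no: "sdrop n p \<noteq> sdrop (n + d) p" if "0 < d" for n d
  proof
    assume "sdrop n p = sdrop (n + d) p"
    then have d: "sdrop d (sdrop n p) = sdrop n p" by (metis sdrop_add)
    let ?q = "stake d (sdrop n p)"
    have q: "oriented_cycle Q ?q"
      using oriented_cycle_period[OF Q sdrop_inf_paths[OF pQ] that d] .
    have "sdrop n p = sdrop 0 (cycle ?q)"
      using sdrop_period_eq_cycle[OF that d] by simp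
    then have "(p, cycle ?q) \<in> tail_equiv Q"
      using pQ cycle_inf_paths[OF Q q] unfolding tail_equiv_def by blast
    then show False using p q by (auto simp: irrational_path_def rational_path_def)
  qed
  have "n = m" if "sdrop n p = sdrop m p" for n m
    using that no[of "m - n" n] no[of "n - m" m] by (metis le_add_diff_inverse linorder_cases
        nat_less_le zero_less_diff)
  then show ?thesis by (auto simp: stable_along_def)
qed

text \<open>With \<open>d\<close> and \<open>length q\<close>, their gcd is also a period, so
  \<open>q\<close> is a power of its initial segment of that length, itself an oriented cycle.
  Simplicity forces the gcd to be \<open>length q\<close>.\<close>

lemma simple_cycle_period_dvd:
  assumes Q: "wf_digraph Q" and q: "simple_cycle Q q" and d: "sdrop d (cycle q) = cycle q"
  shows "length q dvd d"
proof (cases "d = 0")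
  case False
  have oc: "oriented_cycle Q q" and ne: "q \<noteq> []"
    using q by (auto simp: simple_cycle_def oriented_cycle_def)
  let ?g = "gcd d (length q)" and ?p = "cycle q"
  have per: "sdrop ?g ?p = ?p"
    using False by (intro sdrop_gcd_period d sdrop_cycle_eq ne) auto
  obtain k where k: "length q = ?g * k" using gcd_dvd2 by (rule dvdE)
  have "q = concat (replicate k (stake ?g ?p))"
    using stake_mult_period[OF per, of k] stake_cycle_eq[OF ne] k by metis
  moreover have "oriented_cycle Q (stake ?g ?p)"
    using False by (intro oriented_cycle_period[OF Q cycle_inf_paths[OF Q oc] _ per]) auto
  ultimately have "\<not> length (stake ?g ?p) < length q"
    using q unfolding simple_cycle_def by blast
  moreover have "?g \<le> length q" using ne by (intro gcd_le2_nat) simp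
  ultimately have "?g = length q" by simp
  then show ?thesis by (metis gcd_dvd1)
qed simp

lemma cycle_stable_along:
  assumes Q: "wf_digraph Q" and q: "simple_cycle Q q" and st: "path_stable c q"
  shows "stable_along c (cycle q)"
proof -
  let ?p = "cycle q" and ?L = "length q"
  have ne: "q \<noteq> []" using q by (auto simp: simple_cycle_def oriented_cycle_def)
  note L = sdrop_cycle_eq[OF ne]
  have mult: "initial_weight c (?L * k) ?p = 1" for k
  proof (induction k)
    case (Suc k)
    have "initial_weight c (?L * Suc k) ?p = initial_weight c ?L ?p * initial_weight c (?L * k) ?p"
      using initial_weight_add[of c ?L "?L * k" ?p] L by simp
    then show ?case
      using Suc st by (simp add: initial_weight_def stake_cycle_eq[OF ne] path_stable_def)
  qed (simp add: initial_weight_def)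
  have *: "initial_weight c n ?p = initial_weight c (n + d) ?p"
    if eq: "sdrop n ?p = sdrop (n + d) ?p" for n d
  proof -
    \<comment> \<open>\<open>r\<close> pads \<open>n\<close> to a multiple of
      \<open>length q\<close>: dropping \<open>r\<close> more entries brings the tail back to
      \<open>cycle q\<close>, which makes \<open>d\<close> a period of \<open>cycle q\<close>
      itself.\<close>
    obtain r where r: "?L * n = n + r"
      using ne by (metis le_Suc_ex length_greater_0_conv less_eq_Suc_le mult_le_mono1 nat_mult_1 One_nat_def)
    have "?L * n + d = n + d + r" using r by simp
    then have "sdrop d (sdrop (?L * n) ?p) = sdrop r (sdrop (n + d) ?p)"
      by (metis sdrop_add)
    also have "\<dots> = sdrop (?L * n) ?p"
      by (metis eq r sdrop_add)
    finally have "sdrop d ?p = ?p" by (simp only: sdrop_mult_period[OF L])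
    then obtain k where k: "d = ?L * k" using simple_cycle_period_dvd[OF Q q] by (auto elim: dvdE)
    \<comment> \<open>The period is split off in front, where its weight is 1.\<close>
    have "initial_weight c (d + n) ?p = initial_weight c n ?p"
      using mult[of k] \<open>sdrop d ?p = ?p\<close> by (simp add: initial_weight_add k)
    then show ?thesis by (simp add: add.commute)
  qed
  show ?thesis
    unfolding stable_along_def
  proof (intro allI impI)
    fix n m assume eq: "sdrop n ?p = sdrop m ?p"
    show "initial_weight c n ?p = initial_weight c m ?p"
    proof (cases "n \<le> m")
      case True
      then show ?thesis using *[of n "m - n"] eq by simp
    next
      case False
      then show ?thesis using *[of m "n - m"] eq by simp
    qed
  qed
qed

section \<open>Isomorphisms between the twists\<close>

lemma weights_nonzero:
  assumes "a \<in> weights Q" "b \<in> weights Q" "\<alpha> \<in> arcs Q"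
  shows "a \<alpha> \<noteq> 0" "b \<alpha> \<noteq> 0"
  using assms by (auto simp: weights_def)

lemma rep_iso_F_class:
  fixes Q :: "('v, 'e) pre_digraph" and a b :: "'e \<Rightarrow> 'k::field"
  assumes Q: "wf_digraph Q" and a: "a \<in> weights Q" and b: "b \<in> weights Q"
    and st: "stable_along (\<lambda>\<alpha>. a \<alpha> * inverse (b \<alpha>)) p"
  shows "rep_iso (lpa Q) (twist Q a (F_class Q (tail_class Q p)))
                         (twist Q b (F_class Q (tail_class Q p)))"
proof -
  let ?C = "tail_class Q p" and ?c = "\<lambda>\<alpha>. a \<alpha> * inverse (b \<alpha>)"
  note nzab = weights_nonzero[OF a b]
  have W: "initial_weight ?c n s \<noteq> 0" if "s \<in> inf_paths Q" for n s
    using that nzab by (intro initial_weight_nonzero[of s "arcs Q"]) (auto simp: inf_paths_def)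
  \<comment> \<open>On the tail class of \<open>p\<close> the value does not depend on the choice,
    by \<open>initial_weight_ratio\<close>; elsewhere it is irrelevant.\<close>
  define l where "l s = (let (m, n) = (SOME (m, n). sdrop m s = sdrop n p)
    in initial_weight ?c m s / initial_weight ?c n p)" for s
  have pQ: "p \<in> inf_paths Q" if "s \<in> ?C" for s
    using that by (auto simp: tail_class_def tail_equiv_def)
  have l: "l s = initial_weight ?c m s / initial_weight ?c n p"
    if "p \<in> inf_paths Q" "sdrop m s = sdrop n p" for s m n
  proof -
    obtain m' n' where mn: "(SOME (m, n). sdrop m s = sdrop n p) = (m', n')" by fastforce
    have "sdrop m' s = sdrop n' p"
      using someI[of "\<lambda>(m, n). sdrop m s = sdrop n p" "(m, n)"] that(2) unfolding mn by simp
    from initial_weight_ratio[OF st that(2) this] show ?thesis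
      using W[OF that(1)] by (simp add: l_def mn field_simps del: inverse_eq_divide)
  qed
  have ex: "\<exists>m n. sdrop m s = sdrop n p" if "s \<in> ?C" for s
    using that unfolding tail_class_def tail_equiv_def by (blast intro: sym)
  have l_nz: "l s \<noteq> 0" if "s \<in> ?C" for s
    using ex[OF that] l[OF pQ[OF that]] W[OF pQ[OF that]] W[OF subsetD[OF tail_class_subset that]]
    by auto
  have l_Cons: "l (\<alpha> ## s) = ?c \<alpha> * l s" if s: "s \<in> ?C" for \<alpha> s
  proof -
    obtain m n where mn: "sdrop m s = sdrop n p" using ex[OF s] by blast
    then have mn': "sdrop (Suc m) (\<alpha> ## s) = sdrop n p" by simp
    show ?thesis
      unfolding l[OF pQ[OF s] mn] l[OF pQ[OF s] mn'] by (simp add: initial_weight_def)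
  qed
  show ?thesis
    unfolding F_class_conv[OF Q]
  proof (rule rep_iso_twist_diag[OF Q a b F_act_class F_rel[OF Q], where l = l])
    fix g s assume g: "g \<in> lpa_gens Q" and s: "s \<in> ?C"
    have sQ: "s \<in> inf_paths Q" using tail_class_subset s by blast
    show "pscale (gen_weight a g) (lin (\<lambda>p. Poly_Mapping.single p (l p)) (F_act Q g s))
      = pscale (gen_weight b g * l s) (F_act Q g s)"
    proof (cases g)
      case (Vertex i)
      then show ?thesis by simp
    next
      case (Arrow \<alpha>)
      have "a \<alpha> * l (stl s) = b \<alpha> * l s" if "\<alpha> = shd s"
      proof -
        \<comment> \<open>This vector is the basis vector of \<open>stl s\<close>, so its support
          yields membership in the class.\<close>
        have "(F_act Q g s :: _ \<Rightarrow>\<^sub>0 'k) \<in> space_on ?C" by (rule F_act_class[OF g s])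
        then have "stl s \<in> ?C" using that by (simp add: Arrow space_on_def)
        from l_Cons[OF this, of "shd s"] show ?thesis
          using nzab[OF shd_inf_path[OF sQ]] that by simp
      qed
      then show ?thesis by (simp add: Arrow)
    next
      case (Ghost \<alpha>)
      then have "\<alpha> \<in> arcs Q" using g by (auto simp: lpa_gens_def)
      then have eq: "inverse (a \<alpha>) * (?c \<alpha> * l s) = inverse (b \<alpha>) * l s"
        using nzab[of \<alpha>] by (simp add: field_simps)
      show ?thesis by (simp add: Ghost l_Cons[OF s] eq)
    qed
  qed (use tail_class_subset[of Q p] l_nz in blast)+
qed

text \<open>A path to a sink is finite, so ratios can be multiplied along all of it, and no
  condition on \<open>a\<close> and \<open>b\<close> arises.\<close>

lemma rep_iso_N_sink:
  fixes Q :: "('v, 'e) pre_digraph" and a b :: "'e \<Rightarrow> 'k::field"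
  assumes Q: "wf_digraph Q" and a: "a \<in> weights Q" and b: "b \<in> weights Q"
  shows "rep_iso (lpa Q) (twist Q a (N_sink Q i)) (twist Q b (N_sink Q i))"
proof -
  interpret wf_digraph Q by fact
  note nzab = weights_nonzero[OF a b]
  let ?l = "\<lambda>(u :: 'v, xs). prod_list (map (\<lambda>\<alpha>. a \<alpha> * inverse (b \<alpha>)) xs)"
  show ?thesis
    unfolding N_sink_conv[OF Q]
  proof (rule rep_iso_twist_diag[OF Q a b N_act_space[OF Q] N_rel[OF Q], where l = ?l])
    fix p assume p: "p \<in> sink_paths_to Q i"
    then have "set (snd p) \<subseteq> arcs Q" by (auto simp: sink_paths_to_def awalk_def)
    then show "?l p \<noteq> 0"
      using nzab by (auto simp: case_prod_beta prod_list_zero_iff)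
    \<comment> \<open>The two cancellations serve the \<open>Arrow\<close> and the
      \<open>Ghost\<close> case.\<close>
    have "b \<alpha> * (a \<alpha> * inverse (b \<alpha>) * y) = a \<alpha> * y"
      "inverse (a \<alpha>) * (a \<alpha> * inverse (b \<alpha>) * y) = inverse (b \<alpha>) * y" if "\<alpha> \<in> arcs Q" for \<alpha> y
      using nzab[OF that] by (simp_all add: field_simps)
    note cancel = this
    fix g assume g: "g \<in> lpa_gens Q"
    show "pscale (gen_weight a g) (lin (\<lambda>p. Poly_Mapping.single p (?l p)) (N_act Q g p))
        = pscale (gen_weight b g * ?l p) (N_act Q g p)"
      using g p
      by (cases "(Q, g, p)" rule: N_act.cases)
        (auto simp: lpa_gens_def sink_paths_to_def awalk_Cons_iff cancel)
  qed (use sink_paths_to_subset[of Q i] in blast)+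
qed

section \<open>From an isomorphism to stability of the cycle\<close>

lemma lookup_lin_F_act_Arrow:
  "Poly_Mapping.lookup (lin (F_act Q (Arrow \<alpha>)) w) s = Poly_Mapping.lookup w (\<alpha> ## s)"
  using space_on_UNIV[of w]
proof (induction w rule: space_on_induct)
  case (single p d)
  then show ?case by (cases p) (auto simp: lookup_single when_def)
qed (simp_all add: lin_add lookup_add)

text \<open>Acting by \<open>q\<close> removes the prefix \<open>q\<close>, so the coefficient at
  \<open>s\<close> comes from \<open>q @- s\<close> alone. The list is reversed because the
  rightmost letter of a word acts first.\<close>

lemma lookup_wop_F_act_path:
  "Poly_Mapping.lookup (wop (F_act Q) (Word (rev (map Arrow q))) w) s = Poly_Mapping.lookup w (q @- s)"
  by (induction q arbitrary: w) (simp_all add: lookup_lin_F_act_Arrow)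

lemma word_weight_path: "word_weight a (Word (rev (map Arrow q))) = prod_list (map a q)"
  by (induction q) (simp_all add: mult.commute)

lemma prod_list_nonzero_weights:
  assumes "a \<in> weights Q" "set q \<subseteq> arcs Q"
  shows "prod_list (map a q) \<noteq> 0"
  using assms by (auto simp: weights_def prod_list_zero_iff)

lemma prod_list_ratio:
  fixes a b :: "'e \<Rightarrow> 'k::field"
  shows "prod_list (map (\<lambda>\<alpha>. a \<alpha> * inverse (b \<alpha>)) q) = prod_list (map a q) / prod_list (map b q)"
  unfolding divide_inverse by (induction q) (simp_all add: mult_ac)

text \<open>Prepending copies of \<open>q\<close> to \<open>s\<close> stays in the finite support,
  so two such streams coincide; cancelling the common prefix makes \<open>s\<close>
  periodic.\<close>

lemma shift_invariant_support:
  fixes w :: "'e stream \<Rightarrow>\<^sub>0 'k::field"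
  assumes ne: "q \<noteq> []" and z: "z \<noteq> 0"
    and shift: "\<And>s. Poly_Mapping.lookup w (q @- s) = z * Poly_Mapping.lookup w s"
    and s: "s \<in> Poly_Mapping.keys w"
  shows "s = cycle q"
proof -
  let ?f = "\<lambda>n. concat (replicate n q) @- s"
  have "?f n \<in> Poly_Mapping.keys w" for n
    by (induction n) (use s z in \<open>auto simp: in_keys_iff shift\<close>)
  then have "finite (range ?f)"
    by (intro finite_subset[OF _ finite_keys[of w]]) auto
  then have "\<not> inj ?f" using finite_imageD infinite_UNIV_nat by blast
  then obtain n m where "n \<noteq> m" "?f n = ?f m" by (auto simp: inj_on_def)
  then obtain n d where d: "0 < d" "?f n = ?f (n + d)"
    by (metis le_add_diff_inverse linorder_neqE_nat nat_less_le zero_less_diff)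
  let ?r = "concat (replicate d q)"
  have "?r \<noteq> []" using d(1) ne by (cases d) auto
  have "concat (replicate n q) @- s = concat (replicate n q) @- ?r @- s"
    using d(2) by (simp add: replicate_add)
  then have s: "s = ?r @- s" by simp
  \<comment> \<open>\<open>cycle q\<close> solves the same fixed-point equation as
    \<open>s\<close>.\<close>
  have "cycle q = concat (replicate k q) @- cycle q" for k
    by (induction k) (simp, metis concat.simps(2) cycle_decomp ne replicate_Suc shift_append)
  then have "cycle q = cycle ?r"
    by (rule shift_fixpoint_eq_cycle[OF \<open>?r \<noteq> []\<close>])
  with shift_fixpoint_eq_cycle[OF \<open>?r \<noteq> []\<close> s] show ?thesis by simp
qed

text \<open>In the \<open>a\<close>-twist, \<open>cycle q\<close> is an eigenvector of
  \<open>q\<close> with eigenvalue \<open>?A\<close>, and its image \<open>?w\<close> has the same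
  eigenvalue in the \<open>b\<close>-twist, where \<open>q\<close> acts as \<open>?B\<close> times
  prefix removal.\<close>

lemma rep_iso_F_class_cycleD:
  fixes Q :: "('v, 'e) pre_digraph" and a b :: "'e \<Rightarrow> 'k::field"
  assumes Q: "wf_digraph Q" and a: "a \<in> weights Q" and b: "b \<in> weights Q"
    and q: "oriented_cycle Q q"
    and iso: "rep_iso (lpa Q) (twist Q a (F_class Q (tail_class Q (cycle q))))
                              (twist Q b (F_class Q (tail_class Q (cycle q))))"
  shows "prod_list (map a q) = prod_list (map b q)"
proof -
  interpret wf_digraph Q by fact
  interpret L: alg_ideal "free_alg (lpa_gens Q)" "lpa_ideal Q :: (('v, 'e) lpa_gen, 'k) free_algebra set"
    by (rule alg_ideal_lpa[OF Q])
  have ne: "q \<noteq> []" and arcs: "set q \<subseteq> arcs Q" using q by (auto simp: oriented_cycle_def)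
  \<comment> \<open>inside the digraph locale, an unqualified \<open>cycle\<close> is the predicate of Graph_Theory\<close>
  let ?C = "tail_class Q (Stream.cycle q)" and ?v = "basis_vec (Stream.cycle q) :: 'e stream \<Rightarrow>\<^sub>0 'k"
  let ?M = "\<lambda>a :: 'e \<Rightarrow> 'k. twist Q a (basis_rep Q ?C (F_act Q))"
  let ?A = "prod_list (map a q)" and ?B = "prod_list (map b q)"
  have A: "?A \<noteq> 0" and B: "?B \<noteq> 0" using prod_list_nonzero_weights a b arcs by blast+
  define f :: "(('v, 'e) lpa_gen, 'k) free_algebra" where "f = basis_vec (Word (rev (map Arrow q)))"
  have f: "f \<in> free_alg (lpa_gens Q)"
    unfolding f_def free_alg_def
  proof (intro single_in_space_on imageI)
    have "Arrow ` set q \<subseteq> lpa_gens Q" using arcs unfolding lpa_gens_def by blast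
    then show "rev (map Arrow q) \<in> lists (lpa_gens Q) - {[]}" using ne by auto
  qed
  have "(Stream.cycle q, Stream.cycle q) \<in> tail_equiv Q"
    using cycle_inf_paths[OF Q q] unfolding tail_equiv_def by blast
  then have v: "?v \<in> space_on ?C" by (intro single_in_space_on) (simp add: tail_class_def)
  have relC: "r \<in> lpa_rels Q \<Longrightarrow> p \<in> ?C \<Longrightarrow> rho (F_act Q) r (basis_vec p) = 0"
    for r :: "(('v, 'e) lpa_gen, 'k) free_algebra" and p
    using F_rel[OF Q] tail_class_subset by blast
  have act: "Poly_Mapping.lookup (ract (?M c) (coset (lpa_ideal Q) f) x) s
      = prod_list (map c q) * Poly_Mapping.lookup x (q @- s)"
    if "c \<in> weights Q" "x \<in> space_on ?C" for c x s
    using ract_twist_basis_rep[where act = "F_act Q", OF Q that(1) F_act_class relC f that(2)]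
      lookup_wop_F_act_path[of Q q x s]
    by (simp add: f_def twist_free_single rho_single word_weight_path del: wop.simps word_weight.simps)
  have sp: "rspace (?M c) = space_on ?C" "rscale (?M c) = pscale" for c
    by (simp_all add: twist_def basis_rep_def)
  obtain \<phi> where bij: "bij_betw \<phi> (space_on ?C) (space_on ?C)"
    and sc: "\<And>d x. x \<in> space_on ?C \<Longrightarrow> \<phi> (pscale d x) = pscale d (\<phi> x)"
    and eqv: "\<And>u x. u \<in> acarrier (lpa Q) \<Longrightarrow> x \<in> space_on ?C \<Longrightarrow>
      \<phi> (ract (?M a) u x) = ract (?M b) u (\<phi> x)"
    using iso unfolding F_class_conv[OF Q] rep_iso_def sp by blast
  let ?w = "\<phi> ?v"
  have w: "?w \<in> space_on ?C" using bij v by (auto dest: bij_betwE)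
  have "\<phi> 0 = 0" using sc[OF v, of 0] by simp
  moreover have "(0 :: 'e stream \<Rightarrow>\<^sub>0 'k) \<in> space_on ?C" by (rule pscale.subspace_0[OF subspace_space_on])
  moreover have "?v \<noteq> 0" by (metis lookup_single_eq lookup_zero zero_neq_one)
  ultimately have "?w \<noteq> 0"
    using inj_onD[OF bij_betw_imp_inj_on[OF bij], of ?v 0] v by auto
  \<comment> \<open>Untwisted, \<open>q\<close> thus fixes \<open>?v\<close>, and the twist
    contributes the factor \<open>?A\<close>.\<close>
  have "(q @- s = Stream.cycle q) = (s = Stream.cycle q)" for s
    using cycle_decomp[OF ne] by (metis shift_left_inj)
  then have av: "ract (?M a) (coset (lpa_ideal Q) f) ?v = pscale ?A ?v"
    by (intro poly_mapping_eqI) (simp add: act[OF a v] lookup_single when_def eq_commute del: pscale_single)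
  have u: "coset (lpa_ideal Q) f \<in> acarrier (lpa Q)"
    using f by (simp add: lpa_def L.carrier_eq)
  have shift: "?A * Poly_Mapping.lookup ?w s = ?B * Poly_Mapping.lookup ?w (q @- s)" for s
    using act[OF b w, of s] unfolding eqv[OF u v, unfolded av sc[OF v], symmetric] by simp
  then have shift': "Poly_Mapping.lookup ?w (q @- s) = (?A / ?B) * Poly_Mapping.lookup ?w s" for s
    using B by (simp add: field_simps)
  obtain s where s: "s \<in> Poly_Mapping.keys ?w" using \<open>?w \<noteq> 0\<close> by fastforce
  have "s = Stream.cycle q" by (rule shift_invariant_support[OF ne _ shift' s]) (use A B in simp)
  \<comment> \<open>Prepending \<open>q\<close> fixes \<open>cycle q\<close>, so
    \<open>shift\<close> compares one nonzero coefficient with itself.\<close>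
  then show ?thesis
    using shift[of "Stream.cycle q"] s cycle_decomp[OF ne] by (simp add: in_keys_iff)
qed

theorem proposition6p1:
  fixes Q :: "('v, 'e) pre_digraph" and a b :: "'e \<Rightarrow> 'k::field"
  assumes "wf_digraph Q" and "a \<in> weights Q" and "b \<in> weights Q"
  shows
    "(\<forall>p. irrational_path Q p \<longrightarrow>
        rep_iso (lpa Q) (twist Q a (F_class Q (tail_class Q p)))
                        (twist Q b (F_class Q (tail_class Q p)))) \<and>
     (\<forall>q. simple_cycle Q q \<longrightarrow>
        (rep_iso (lpa Q) (twist Q a (F_class Q (tail_class Q (cycle q))))
                         (twist Q b (F_class Q (tail_class Q (cycle q))))
         \<longleftrightarrow> path_stable (\<lambda>\<alpha>. a \<alpha> * inverse (b \<alpha>)) q)) \<and>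
     (\<forall>i. sink Q i \<longrightarrow>
        rep_iso (lpa Q) (twist Q a (N_sink Q i)) (twist Q b (N_sink Q i)))"
proof (intro conjI allI impI)
  fix p assume "irrational_path Q p"
  then show "rep_iso (lpa Q) (twist Q a (F_class Q (tail_class Q p)))
                             (twist Q b (F_class Q (tail_class Q p)))"
    by (intro rep_iso_F_class[OF assms] irrational_stable_along[OF assms(1)])
next
  fix q assume q: "simple_cycle Q q"
  then have oc: "oriented_cycle Q q" by (simp add: simple_cycle_def)
  then have "set q \<subseteq> arcs Q"
    by (auto simp: oriented_cycle_def pre_digraph.awalk_def)
  then have b: "prod_list (map b q) \<noteq> 0" by (rule prod_list_nonzero_weights[OF assms(3)])
  then have "path_stable (\<lambda>\<alpha>. a \<alpha> * inverse (b \<alpha>)) q \<longleftrightarrow> prod_list (map a q) = prod_list (map b q)"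
    unfolding path_stable_def prod_list_ratio by simp
  then show "rep_iso (lpa Q) (twist Q a (F_class Q (tail_class Q (cycle q))))
                         (twist Q b (F_class Q (tail_class Q (cycle q))))
         \<longleftrightarrow> path_stable (\<lambda>\<alpha>. a \<alpha> * inverse (b \<alpha>)) q"
    using rep_iso_F_class_cycleD[OF assms oc] rep_iso_F_class[OF assms cycle_stable_along[OF assms(1) q]]
    by (intro iffI) simp_all
next
  fix i assume "sink Q i"
  show "rep_iso (lpa Q) (twist Q a (N_sink Q i)) (twist Q b (N_sink Q i))"
    by (rule rep_iso_N_sink[OF assms])
qed

end
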